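(* Let $n,d\ge1$, let $H$ be a nonzero $2^n\times2^n$ complex matrix, and let $p_d(H)=a_0I+a_1H+\cdots+a_dH^d$ with $a_k\in\mathbb C$, $a_d\neq0$. Suppose the state-preparation oracles $P_R,P_L$ of $H$ satisfy $P_R=V_R\cdot A_R$ and $P_L=V_L\cdot A_L$ with unitaries on $2n$ qubits such that $V_R|0\rangle_{2n}=|0\rangle_{2n}$, $V_L|0\rangle_{2n}=|0\rangle_{2n}$, and $A_R,A_L$ consist of only $O(1)$ single-qubit gates. Then the block-encoding circuit of $p_d(H)$ $$W=\mathrm{POLY}_L^\dagger\cdot\big[C_1(P_L^\dagger)\cdots C_d(P_L^\dagger)\big]\cdot\big[\mathrm{SELECT}_d\cdots\mathrm{SELECT}_1\big]\cdot\big[C_d(P_R)\cdots C_1(P_R)\big]\cdot\mathrm{POLY}_R$$ can be simplified to $$\widetilde W=\mathrm{POLY}_L^\dagger\cdot\big[C_1(A_L^\dagger)\cdots C_d(A_L^\dagger)\big]\cdot\prod_{s=1}^d (V_L^\dagger)_s\cdot\big[\mathrm{SELECT}_d\cdots\mathrm{SELECT}_1\big]\cdot\prod_{s=1}^d (V_R)_s\cdot\big[C_d(A_R)\cdots C_1(A_R)\big]\cdot\mathrm{POLY}_R ,$$ in the sense that, with all ancilla qubits initialized in and post-selected on $|0\rangle$, for every $n$-qubit state $|\varphi\rangle$, $$\big(\langle 0|_{d}\otimes\langle0|_{2dn}\otimes I_n\big)\,W\,\big(|0\rangle_d|0\rangle_{2dn}|\varphi\rangle\big)=\big(\langle 0|_{d}\otimes\langle0|_{2dn}\otimes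 I_n\big)\,\widetilde W\,\big(|0\rangle_d|0\rangle_{2dn}|\varphi\rangle\big).$$ (Notation in the context.)
   Context: $I_m$ is the identity on $m$ qubits, $|0\rangle_m$ the all-zero state of $m$ qubits. For $i\in\{0,\dots,2^n-1\}$ with bits $\mathtt i_0,\dots,\mathtt i_{n-1}$, $|i\rangle=|\mathtt i_0\rangle\otimes\cdots\otimes|\mathtt i_{n-1}\rangle$. $X,Z$ are the Pauli matrices. $\arg 0$ is given any fixed value. Write $H=\sum_{i,j=0}^{2^n-1}\alpha_{ij}\bigotimes_{\ell=0}^{n-1}Z^{\mathtt j_\ell}X^{\mathtt i_\ell}$ with $\alpha_{ij}\in\mathbb C$ and $\mathcal N=\sum_{i,j}|\alpha_{ij}|$. State-preparation oracles $P_R,P_L$ are unitaries on $2n$ qubits with $$P_R|0\rangle_{2n}=\tfrac1{\sqrt{\mathcal N}}\sum_{i,j}e^{\mathrm i\arg\alpha_{ij}}\sqrt{|\alpha_{ij}|}\,|i\rangle|j\rangle,\qquad P_L|0\rangle_{2n}=\tfrac1{\sqrt{\mathcal N}}\sum_{i,j}\sqrt{|\alpha_{ij}|}\,|i\rangle|j\rangle .$$ $\mathrm{SELECT}$ acts on three $n$-qubit registers by $\mathrm{SELECT}\,|i\rangle|j\rangle|\varphi\rangle=|i\rangle|j\rangle\otimes\big(\bigotimes_{\ell}Z^{\mathtt j_\ell}X^{\mathtt i_\ell}\big)|\varphi\rangle$. Let $w_k=\sqrt{|a_k|\mathcal N^k}$ for $0\le k\le d$, $\phi_k=\arg(a_{k+1})-\arg(a_k)$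 for $0\le k\le d-1$, and $\mathcal W=\sum_{k=0}^d w_k^2$. Let $|k_u\rangle$ be the unary $d$-qubit state $|1\cdots10\cdots0\rangle$ with $k$ leading ones. $\mathrm{POLY}_R,\mathrm{POLY}_L$ are unitaries on $d$ qubits with $$\mathrm{POLY}_R|0\rangle_d=\tfrac1{\sqrt{\mathcal W}}\sum_{k=0}^d e^{\mathrm i\sum_{j=0}^{k-1}\phi_j}w_k|k_u\rangle,\qquad \mathrm{POLY}_L|0\rangle_d=\tfrac1{\sqrt{\mathcal W}}\sum_{k=0}^d w_k|k_u\rangle .$$ The qubits of the circuit are: $d$ outer ancillas; $d$ inner ancilla registers of $2n$ qubits each, labelled $s=1,\dots,d$; and an $n$-qubit system register. $\mathrm{POLY}_R$ and $\mathrm{POLY}_L^\dagger$ act on the outer ancillas. $(V)_s$ is $V$ acting on the $s$-th inner register; $C_s(V)$ is $V$ on the $s$-th inner register controlled (on value $1$) by the $s$-th outer ancilla. $\mathrm{SELECT}_s$ is $\mathrm{SELECT}$ acting on the $s$-th inner register and the system register. Operators act from right to left and trivially on unmentioned qubits. "$O(1)$ single-qubit gates" means a number of single-qubit gates bounded by a constant independent of $n$. *)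

theory Defs
  imports Complex_Main "Jordan_Normal_Form.Schur_Decomposition"
begin

text \<open>
  Operators and states on \<open>m\<close> qubits are matrices and vectors of dimension \<open>2 ^ m\<close>. The tensor
  factor of qubit \<open>0\<close> comes first and so carries the most significant bit of a basis index.
\<close>

definition bits_of :: "nat \<Rightarrow> nat \<Rightarrow> bool list" where
  "bits_of m i = map (\<lambda>l. bit i (m - 1 - l)) [0..<m]"

definition val_of :: "bool list \<Rightarrow> nat" where
  "val_of bs = horner_sum of_bool 2 (rev bs)"

definition kron :: "complex mat \<Rightarrow> complex mat \<Rightarrow> complex mat" where
  "kron A B = mat (dim_row A * dim_row B) (dim_col A * dim_col B)
     (\<lambda>(r, c). A $$ (r div dim_row B, c div dim_col B) * B $$ (r mod dim_row B, c mod dim_col B))"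

definition vkron :: "complex vec \<Rightarrow> complex vec \<Rightarrow> complex vec" where
  "vkron u v = vec (dim_vec u * dim_vec v) (\<lambda>k. u $ (k div dim_vec v) * v $ (k mod dim_vec v))"

definition ket_bits :: "bool list \<Rightarrow> complex vec" where
  "ket_bits bs = foldr vkron (map (\<lambda>b. unit_vec 2 (of_bool b)) bs) (unit_vec 1 0)"

definition ket :: "nat \<Rightarrow> nat \<Rightarrow> complex vec" where
  "ket m i = ket_bits (bits_of m i)"

definition bra :: "complex vec \<Rightarrow> complex mat" where
  "bra v = mat_of_row (conjugate v)"

definition qubit_state :: "nat \<Rightarrow> complex vec \<Rightarrow> bool" where
  "qubit_state m v \<longleftrightarrow> v \<in> carrier_vec (2 ^ m) \<and> v \<bullet>c v = 1"

definition unitary_on :: "nat \<Rightarrow> complex mat \<Rightarrow> bool" where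
  "unitary_on m U \<longleftrightarrow> U \<in> carrier_mat (2 ^ m) (2 ^ m) \<and>
     mat_adjoint U * U = 1\<^sub>m (2 ^ m) \<and> U * mat_adjoint U = 1\<^sub>m (2 ^ m)"

text \<open>
  \<open>on_qubits N qs U\<close> is the operator on \<open>N\<close> qubits that applies \<open>U\<close> to the qubits listed in \<open>qs\<close>
  (in this order) and the identity to all other qubits. It is meant for distinct \<open>qs\<close> below \<open>N\<close>;
  for contiguous qubits it is \<open>I \<otimes> U \<otimes> I\<close>, see \<open>on_qubits_block\<close> below.
\<close>

definition on_qubits :: "nat \<Rightarrow> nat list \<Rightarrow> complex mat \<Rightarrow> complex mat" where
  "on_qubits N qs U = mat (2 ^ N) (2 ^ N) (\<lambda>(r, c).
     if \<forall>q<N. q \<notin> set qs \<longrightarrow> bits_of N r ! q = bits_of N c ! q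
     then U $$ (val_of (map ((!) (bits_of N r)) qs), val_of (map ((!) (bits_of N c)) qs))
     else 0)"

text \<open>Block form: the control qubit is the first tensor factor.\<close>

definition controlled :: "complex mat \<Rightarrow> complex mat" where
  "controlled U = (let k = dim_row U in four_block_mat (1\<^sub>m k) (0\<^sub>m k k) (0\<^sub>m k k) U)"

text \<open>Product in list order; the rightmost factor acts first.\<close>

definition mprod :: "nat \<Rightarrow> complex mat list \<Rightarrow> complex mat" where
  "mprod m As = foldr (*) As (1\<^sub>m (2 ^ m))"

definition single_qubit_gates :: "nat \<Rightarrow> nat \<Rightarrow> complex mat \<Rightarrow> bool" where
  "single_qubit_gates m C A \<longleftrightarrow>
     (\<exists>gs :: (nat \<times> complex mat) list. length gs \<le> C \<and> (\<forall>(q, g)\<in>set gs. q < m \<and> unitary_on 1 g) \<and>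
       A = mprod m (map (\<lambda>(q, g). on_qubits m [q] g) gs))"

definition pauli_X :: "complex mat" where
  "pauli_X = mat_of_rows_list 2 [[0, 1], [1, 0]]"

definition pauli_Z :: "complex mat" where
  "pauli_Z = mat_of_rows_list 2 [[1, 0], [0, -1]]"

definition pauli_string :: "nat \<Rightarrow> nat \<Rightarrow> nat \<Rightarrow> complex mat" where
  "pauli_string n i j = foldr kron
     (map (\<lambda>l. (pauli_Z ^\<^sub>m of_bool (bits_of n j ! l)) * (pauli_X ^\<^sub>m of_bool (bits_of n i ! l))) [0..<n])
     (1\<^sub>m 1)"

definition pauli_sum :: "nat \<Rightarrow> (nat \<Rightarrow> nat \<Rightarrow> complex) \<Rightarrow> complex mat" where
  "pauli_sum n \<alpha> = mat (2 ^ n) (2 ^ n)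
     (\<lambda>(r, c). \<Sum>i<2^n. \<Sum>j<2^n. \<alpha> i j * pauli_string n i j $$ (r, c))"

definition coeff_norm :: "nat \<Rightarrow> (nat \<Rightarrow> nat \<Rightarrow> complex) \<Rightarrow> real" where
  "coeff_norm n \<alpha> = (\<Sum>i<2^n. \<Sum>j<2^n. cmod (\<alpha> i j))"

text \<open>The argument function with value \<open>\<theta>\<close> at \<open>0\<close>.\<close>

definition arg_at0 :: "real \<Rightarrow> complex \<Rightarrow> real" where
  "arg_at0 \<theta> z = (if z = 0 then \<theta> else Arg z)"

definition prep_state_R :: "real \<Rightarrow> nat \<Rightarrow> (nat \<Rightarrow> nat \<Rightarrow> complex) \<Rightarrow> complex vec" where
  "prep_state_R \<theta> n \<alpha> = complex_of_real (1 / sqrt (coeff_norm n \<alpha>)) \<cdot>\<^sub>v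
     finsum_vec TYPE(complex) (2 ^ (2 * n))
       (\<lambda>(i, j). (exp (\<i> * complex_of_real (arg_at0 \<theta> (\<alpha> i j))) * complex_of_real (sqrt (cmod (\<alpha> i j))))
          \<cdot>\<^sub>v vkron (ket n i) (ket n j))
       ({..<2 ^ n} \<times> {..<2 ^ n})"

definition prep_state_L :: "nat \<Rightarrow> (nat \<Rightarrow> nat \<Rightarrow> complex) \<Rightarrow> complex vec" where
  "prep_state_L n \<alpha> = complex_of_real (1 / sqrt (coeff_norm n \<alpha>)) \<cdot>\<^sub>v
     finsum_vec TYPE(complex) (2 ^ (2 * n))
       (\<lambda>(i, j). complex_of_real (sqrt (cmod (\<alpha> i j))) \<cdot>\<^sub>v vkron (ket n i) (ket n j))
       ({..<2 ^ n} \<times> {..<2 ^ n})"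

text \<open>
  The basis index \<open>(i * 2 ^ n + j) * 2 ^ n + k\<close> of \<open>3 * n\<close> qubits belongs to \<open>|i\<rangle>|j\<rangle>|k\<rangle>\<close>;
  see \<open>select_action\<close> below.
\<close>

definition select_op :: "nat \<Rightarrow> complex mat" where
  "select_op n = mat (2 ^ (3 * n)) (2 ^ (3 * n)) (\<lambda>(r, c).
     if r div 2 ^ n = c div 2 ^ n
     then pauli_string n (c div 2 ^ n div 2 ^ n) (c div 2 ^ n mod 2 ^ n) $$ (r mod 2 ^ n, c mod 2 ^ n)
     else 0)"

definition weight :: "real \<Rightarrow> (nat \<Rightarrow> complex) \<Rightarrow> nat \<Rightarrow> real" where
  "weight \<N> a k = sqrt (cmod (a k) * \<N> ^ k)"

definition phase :: "real \<Rightarrow> (nat \<Rightarrow> complex) \<Rightarrow> nat \<Rightarrow> real" where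
  "phase \<theta> a k = arg_at0 \<theta> (a (Suc k)) - arg_at0 \<theta> (a k)"

definition weight_norm :: "real \<Rightarrow> nat \<Rightarrow> (nat \<Rightarrow> complex) \<Rightarrow> real" where
  "weight_norm \<N> d a = (\<Sum>k\<le>d. (weight \<N> a k)\<^sup>2)"

definition unary_ket :: "nat \<Rightarrow> nat \<Rightarrow> complex vec" where
  "unary_ket d k = ket_bits (replicate k True @ replicate (d - k) False)"

definition poly_state_R :: "real \<Rightarrow> real \<Rightarrow> nat \<Rightarrow> (nat \<Rightarrow> complex) \<Rightarrow> complex vec" where
  "poly_state_R \<theta> \<N> d a = complex_of_real (1 / sqrt (weight_norm \<N> d a)) \<cdot>\<^sub>v
     finsum_vec TYPE(complex) (2 ^ d)
       (\<lambda>k. (exp (\<i> * complex_of_real (\<Sum>j<k. phase \<theta> a j)) * complex_of_real (weight \<N> a k))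
          \<cdot>\<^sub>v unary_ket d k)
       {..d}"

definition poly_state_L :: "real \<Rightarrow> nat \<Rightarrow> (nat \<Rightarrow> complex) \<Rightarrow> complex vec" where
  "poly_state_L \<N> d a = complex_of_real (1 / sqrt (weight_norm \<N> d a)) \<cdot>\<^sub>v
     finsum_vec TYPE(complex) (2 ^ d)
       (\<lambda>k. complex_of_real (weight \<N> a k) \<cdot>\<^sub>v unary_ket d k) {..d}"

text \<open>
  Layout of the circuit: \<open>d\<close> outer ancillas, then \<open>d\<close> inner registers of \<open>2 * n\<close> qubits, then the
  \<open>n\<close> system qubits. Registers and outer ancillas are numbered from \<open>1\<close>, qubits from \<open>0\<close>.
\<close>

definition total_qubits :: "nat \<Rightarrow> nat \<Rightarrow> nat" where
  "total_qubits n d = d + 2 * d * n + n"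

definition inner_reg :: "nat \<Rightarrow> nat \<Rightarrow> nat \<Rightarrow> nat list" where
  "inner_reg n d s = [d + 2 * n * (s - 1) ..< d + 2 * n * s]"

definition system_reg :: "nat \<Rightarrow> nat \<Rightarrow> nat list" where
  "system_reg n d = [d + 2 * d * n ..< d + 2 * d * n + n]"

definition on_outer :: "nat \<Rightarrow> nat \<Rightarrow> complex mat \<Rightarrow> complex mat" where
  "on_outer n d U = on_qubits (total_qubits n d) [0..<d] U"

definition on_inner :: "nat \<Rightarrow> nat \<Rightarrow> nat \<Rightarrow> complex mat \<Rightarrow> complex mat" where
  "on_inner n d s V = on_qubits (total_qubits n d) (inner_reg n d s) V"

definition ctrl_inner :: "nat \<Rightarrow> nat \<Rightarrow> nat \<Rightarrow> complex mat \<Rightarrow> complex mat" where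
  "ctrl_inner n d s V = on_qubits (total_qubits n d) ((s - 1) # inner_reg n d s) (controlled V)"

definition select_at :: "nat \<Rightarrow> nat \<Rightarrow> nat \<Rightarrow> complex mat" where
  "select_at n d s = on_qubits (total_qubits n d) (inner_reg n d s @ system_reg n d) (select_op n)"

definition circuit_W ::
  "nat \<Rightarrow> nat \<Rightarrow> complex mat \<Rightarrow> complex mat \<Rightarrow> complex mat \<Rightarrow> complex mat \<Rightarrow> complex mat" where
  "circuit_W n d POLY_R POLY_L P_R P_L =
     (let N = total_qubits n d in mprod N
       [on_outer n d (mat_adjoint POLY_L),
        mprod N (map (\<lambda>s. ctrl_inner n d s (mat_adjoint P_L)) [1..<d+1]),
        mprod N (map (\<lambda>s. select_at n d s) (rev [1..<d+1])),
        mprod N (map (\<lambda>s. ctrl_inner n d s P_R) (rev [1..<d+1])),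
        on_outer n d POLY_R])"

definition circuit_W_simplified ::
  "nat \<Rightarrow> nat \<Rightarrow> complex mat \<Rightarrow> complex mat \<Rightarrow> complex mat \<Rightarrow> complex mat \<Rightarrow> complex mat \<Rightarrow> complex mat
    \<Rightarrow> complex mat" where
  "circuit_W_simplified n d POLY_R POLY_L V_R V_L A_R A_L =
     (let N = total_qubits n d in mprod N
       [on_outer n d (mat_adjoint POLY_L),
        mprod N (map (\<lambda>s. ctrl_inner n d s (mat_adjoint A_L)) [1..<d+1]),
        mprod N (map (\<lambda>s. on_inner n d s (mat_adjoint V_L)) [1..<d+1]),
        mprod N (map (\<lambda>s. select_at n d s) (rev [1..<d+1])),
        mprod N (map (\<lambda>s. on_inner n d s V_R) [1..<d+1]),
        mprod N (map (\<lambda>s. ctrl_inner n d s A_R) (rev [1..<d+1])),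
        on_outer n d POLY_R])"

definition ancilla_init :: "nat \<Rightarrow> nat \<Rightarrow> complex vec \<Rightarrow> complex vec" where
  "ancilla_init n d \<phi> = vkron (vkron (ket d 0) (ket (2 * d * n) 0)) \<phi>"

definition ancilla_postselect :: "nat \<Rightarrow> nat \<Rightarrow> complex mat" where
  "ancilla_postselect n d = kron (kron (bra (ket d 0)) (bra (ket (2 * d * n) 0))) (1\<^sub>m (2 ^ n))"


lemma val_of_simps [simp]:
  "val_of [] = 0" "val_of (b # bs) = of_bool b * 2 ^ length bs + val_of bs"
  by (simp_all add: val_of_def horner_sum_append)

lemma val_of_less: "val_of bs < 2 ^ length bs"
  by (induction bs) auto

lemma vkron_unit_vec:
  assumes "i < m" "j < k"
  shows "vkron (unit_vec m i) (unit_vec k j) = unit_vec (m * k) (i * k + j)"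
proof (rule eq_vecI)
  have lt: "i * k + j < m * k"
    using assms by (metis add.commute less_nat_zero_code mod_less mod_mult_self1 mult_less_cancel2
        div_less_iff_less_mult div_mult_self1 div_less neq0_conv add.right_neutral add_0 gr_implies_not0)
  fix x assume "x < dim_vec (unit_vec (m * k) (i * k + j))"
  then have x: "x < m * k" by simp
  then have k: "0 < k" by (cases k) auto
  have "x = i * k + j \<longleftrightarrow> x div k = i \<and> x mod k = j"
    using assms by (metis add.commute div_mult_mod_eq div_mult_self3 div_less mod_mult_self3 mod_less
        add_0 less_nat_zero_code)
  then show "vkron (unit_vec m i) (unit_vec k j) $ x = unit_vec (m * k) (i * k + j) $ x"
    using assms x k lt by (auto simp: vkron_def less_mult_imp_div_less)
qed (simp add: vkron_def)

lemma ket_bits_eq: "ket_bits bs = unit_vec (2 ^ length bs) (val_of bs)"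
proof (induction bs)
  case Nil
  then show ?case by (simp add: ket_bits_def)
next
  case (Cons b bs)
  have "ket_bits (b # bs) = vkron (unit_vec 2 (of_bool b)) (ket_bits bs)"
    by (simp add: ket_bits_def)
  then show ?case
    using Cons vkron_unit_vec[of "of_bool b" 2 "val_of bs" "2 ^ length bs"] val_of_less[of bs] by simp
qed

lemma val_of_bits_of: assumes "i < 2 ^ m" shows "val_of (bits_of m i) = i"
proof -
  have "rev (bits_of m i) = map (bit i) [0..<m]"
    by (rule nth_equalityI) (auto simp: bits_of_def rev_nth)
  then show ?thesis
    using assms by (simp add: val_of_def horner_sum_bit_eq_take_bit take_bit_nat_eq_self)
qed

lemma ket_eq: "i < 2 ^ m \<Longrightarrow> ket m i = unit_vec (2 ^ m) i"
  by (simp add: ket_def ket_bits_eq val_of_bits_of) (simp add: bits_of_def)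

lemma kron_carrier:
  "A \<in> carrier_mat a b \<Longrightarrow> B \<in> carrier_mat c d \<Longrightarrow> kron A B \<in> carrier_mat (a * c) (b * d)"
  by (auto simp: kron_def)

lemma pauli_string_carrier: "pauli_string n i j \<in> carrier_mat (2 ^ n) (2 ^ n)"
proof -
  have P: "(pauli_Z ^\<^sub>m of_bool x) * (pauli_X ^\<^sub>m of_bool y) \<in> carrier_mat 2 2" for x y
    by (auto simp: pauli_X_def pauli_Z_def mat_of_rows_list_def)
  have "foldr kron (map (\<lambda>l. (pauli_Z ^\<^sub>m of_bool (f l)) * (pauli_X ^\<^sub>m of_bool (g l))) ls) (1\<^sub>m 1)
      \<in> carrier_mat (2 ^ length ls) (2 ^ length ls)" for f g and ls :: "nat list"
  proof (induction ls)
    case (Cons l ls)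
    then show ?case using kron_carrier[OF P[of "f l" "g l"] Cons] by simp
  qed simp
  from this[of "\<lambda>l. bits_of n j ! l" "\<lambda>l. bits_of n i ! l" "[0..<n]"]
  show ?thesis by (simp add: pauli_string_def)
qed

lemma block_index_less: "i < (m::nat) \<Longrightarrow> j < k \<Longrightarrow> i * k + j < m * k"
  by (metis Suc_leI add.commute add_less_cancel_left less_le_trans mult_Suc mult_le_mono1)

lemma select_action:
  assumes "i < 2 ^ n" "j < 2 ^ n" and \<phi>: "\<phi> \<in> carrier_vec (2 ^ n)"
  shows "select_op n *\<^sub>v vkron (vkron (ket n i) (ket n j)) \<phi> =
    vkron (vkron (ket n i) (ket n j)) (pauli_string n i j *\<^sub>v \<phi>)"
proof -
  define D :: nat where "D = 2 ^ n"
  define K where "K = i * D + j"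
  define P where "P = pauli_string n i j"
  have D: "0 < D" "i < D" "j < D" "dim_vec \<phi> = D" and DDD: "2 ^ (3 * n) = D * D * D"
    using assms by (auto simp: D_def simp flip: power_add) 
  have K: "K < D * D" "K div D = i" "K mod D = j"
    using D block_index_less by (auto simp: K_def)
  have kk: "vkron (ket n i) (ket n j) = unit_vec (D * D) K"
    using assms vkron_unit_vec[of i D j D] by (simp add: ket_eq D_def K_def)
  have P: "P \<in> carrier_mat D D" by (simp add: P_def D_def pauli_string_carrier)
  have sel: "select_op n = mat (D * D * D) (D * D * D) (\<lambda>(r, c). if r div D = c div D
      then pauli_string n (c div D div D) (c div D mod D) $$ (r mod D, c mod D) else 0)"
    unfolding select_op_def DDD D_def by simp
  show ?thesis unfolding kk P_def[symmetric]
  proof (rule eq_vecI)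
    show "dim_vec (select_op n *\<^sub>v vkron (unit_vec (D * D) K) \<phi>) =
        dim_vec (vkron (unit_vec (D * D) K) (P *\<^sub>v \<phi>))"
      using P by (simp add: sel vkron_def)
    fix r assume "r < dim_vec (vkron (unit_vec (D * D) K) (P *\<^sub>v \<phi>))"
    then have r: "r < D * D * D" using P by (simp add: vkron_def)
    have rD: "r div D < D * D" "r mod D < D" using r D by (simp_all add: less_mult_imp_div_less)
    have uv: "unit_vec (D * D) K $ (c div D) = (if c div D = K then 1 else 0)" if "c < D * D * D" for c
      using less_mult_imp_div_less[OF that] K(1) by (simp add: unit_vec_def)
    have vk: "vkron (unit_vec (D * D) K) \<phi> = vec (D * D * D) (\<lambda>c. if c div D = K then \<phi> $ (c mod D) else 0)"
      by (rule eq_vecI) (simp_all only: uv vkron_def dim_vec index_vec D(4) index_unit_vec(3)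
        mult_1_left mult_zero_left if_distrib[where f = "\<lambda>x. x * _"])
    have "(select_op n *\<^sub>v vkron (unit_vec (D * D) K) \<phi>) $ r =
      (\<Sum>c<D * D * D. (if r div D = c div D
        then pauli_string n (c div D div D) (c div D mod D) $$ (r mod D, c mod D) else 0) *
        (if c div D = K then \<phi> $ (c mod D) else 0))"
      unfolding vk using r by (simp add: sel scalar_prod_def lessThan_atLeast0)
    also have "\<dots> = (\<Sum>c\<in>{c. c < D * D * D \<and> c div D = K}.
        (if r div D = K then P $$ (r mod D, c mod D) * \<phi> $ (c mod D) else 0))"
      by (rule sum.mono_neutral_cong_right) (auto simp: K P_def)
    also have "\<dots> = (\<Sum>k<D. if r div D = K then P $$ (r mod D, k) * \<phi> $ k else 0)"
    proof (rule sum.reindex_bij_witness[where i = "\<lambda>k. K * D + k" and j = "\<lambda>c. c mod D"])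
    qed (use D K block_index_less in \<open>auto simp: div_mult_mod_eq\<close>)
    also have "\<dots> = vkron (unit_vec (D * D) K) (P *\<^sub>v \<phi>) $ r"
      using r rD P D K by (auto simp: vkron_def scalar_prod_def lessThan_atLeast0)
    finally show "(select_op n *\<^sub>v vkron (unit_vec (D * D) K) \<phi>) $ r =
        vkron (unit_vec (D * D) K) (P *\<^sub>v \<phi>) $ r" .
  qed
qed

lemma on_qubits_block:
  assumes "U \<in> carrier_mat (2 ^ b) (2 ^ b)"
  shows "on_qubits (a + b + c) [a..<a + b] U = kron (kron (1\<^sub>m (2 ^ a)) U) (1\<^sub>m (2 ^ c))"
proof -
  let ?N = "a + b + c"
  have val: "val_of (map ((!) (bits_of ?N r)) [a..<a + b]) = r div 2 ^ c mod 2 ^ b" for r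
  proof -
    have "rev (map ((!) (bits_of ?N r)) [a..<a + b]) = map (bit (drop_bit c r)) [0..<b]"
      by (rule nth_equalityI) (auto simp: rev_nth bits_of_def bit_drop_bit_eq intro!: arg_cong[where f = "bit r"])
    then show ?thesis
      by (simp add: val_of_def horner_sum_bit_eq_take_bit take_bit_eq_mod drop_bit_eq_div)
  qed
  have agree: "(\<forall>q<?N. q \<notin> set [a..<a + b] \<longrightarrow> bits_of ?N r ! q = bits_of ?N s ! q) \<longleftrightarrow>
      r div 2 ^ c div 2 ^ b = s div 2 ^ c div 2 ^ b \<and> r mod 2 ^ c = s mod 2 ^ c"
    if rs: "r < 2 ^ ?N" "s < 2 ^ ?N" for r s
  proof -
    have high: "bit r q = bit s q" if "?N \<le> q" for q
    proof -
      have "take_bit ?N r = r" "take_bit ?N s = s" using rs by (simp_all add: take_bit_nat_eq_self)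
      then show ?thesis using that by (metis bit_take_bit_iff not_le)
    qed
    have "(\<forall>q<?N. q \<notin> set [a..<a + b] \<longrightarrow> bits_of ?N r ! q = bits_of ?N s ! q) \<longleftrightarrow>
       (\<forall>p<?N. p < c \<or> b + c \<le> p \<longrightarrow> bit r p = bit s p)" (is "?L \<longleftrightarrow> ?R")
    proof
      assume L: ?L
      show ?R
      proof (intro allI impI)
        fix p assume p: "p < ?N" "p < c \<or> b + c \<le> p"
        then have "?N - 1 - p < ?N" "?N - 1 - p \<notin> set [a..<a + b]" "?N - 1 - (?N - 1 - p) = p" by auto
        then show "bit r p = bit s p" using L by (force simp: bits_of_def)
      qed
    next
      assume R: ?R
      show ?L
      proof (intro allI impI)
        fix q assume q: "q < ?N" "q \<notin> set [a..<a + b]"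
        then have "?N - 1 - q < ?N" "?N - 1 - q < c \<or> b + c \<le> ?N - 1 - q" by auto
        then show "bits_of ?N r ! q = bits_of ?N s ! q" using q R[rule_format, of "?N - 1 - q"] by (simp add: bits_of_def)
      qed
    qed
    also have "\<dots> \<longleftrightarrow> (\<forall>p. p < c \<or> b + c \<le> p \<longrightarrow> bit r p = bit s p)"
      using high by (meson not_le)
    also have "\<dots> \<longleftrightarrow> drop_bit (b + c) r = drop_bit (b + c) s \<and> take_bit c r = take_bit c s"
      by (auto simp: bit_eq_iff bit_drop_bit_eq bit_take_bit_iff) (metis le_add_diff_inverse)+
    finally show ?thesis
      by (simp add: drop_bit_eq_div take_bit_eq_mod div_mult2_eq[symmetric] power_add mult.commute)
  qed
  have pw: "(2::nat) ^ ?N = 2 ^ a * 2 ^ b * 2 ^ c" by (simp add: power_add)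
  have "r div 2 ^ c < 2 ^ a * 2 ^ b" "r div 2 ^ c div 2 ^ b < 2 ^ a" if "r < 2 ^ ?N" for r :: nat
    using that by (auto simp: pw less_mult_imp_div_less)
  then show ?thesis using assms
    by (intro eq_matI) (auto simp: on_qubits_def kron_def val agree simp flip: pw simp del: set_upt)
qed

end

(*
  A register s in state |0> satisfies (V_R)_s C_s(A_R) = C_s(V_R A_R): if the control is 1, both sides
  are V_R A_R, and if it is 0, then V_R fixes |0>. Operators on different registers commute and the
  registers start in |0>, so the factors V_R can be absorbed one by one. The part of the circuit
  after the SELECTs is the adjoint of a circuit of the same shape as the part before them, and
  post-selecting on |0> is the adjoint of initializing in |0>, so the left side reduces to the same
  statement, whatever the SELECTs in between do.
*)
theory Submission
  imports Defs
begin

text \<open>The two circuits need not be equal as matrices: a factor V can be moved into a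
  controlled gate only on vectors whose inner register is in |0>. Such vectors are in general no
  product states, because the outer ancillas are in superposition and other registers have become
  entangled with them. All identities are therefore proved for vectors, with a condition on the
  support (\<open>zero_on\<close>) in place of a tensor factor |0>. A control qubit and its inner
  register are in general not adjacent, so the gates have no simple Kronecker form either. Basis
  indices are instead handled through two operations on a list of qubits, reading its value
  (\<open>reg_val\<close>) and overwriting it (\<open>reg_upd\<close>).\<close>

section \<open>Products of operators and their adjoints\<close>

lemma mprod_carrier:
  assumes "set As \<subseteq> carrier_mat (2 ^ m) (2 ^ m)"
  shows "mprod m As \<in> carrier_mat (2 ^ m) (2 ^ m)"
  using assms by (induction As) (auto simp: mprod_def)

text \<open>Passes from products of gates to gates acting one after the other, the form in which
  absorption is proved.\<close>

lemma mprod_mult_vec: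
  assumes "set As \<subseteq> carrier_mat (2 ^ m) (2 ^ m)" "x \<in> carrier_vec (2 ^ m)"
  shows "mprod m As *\<^sub>v x = foldr (*\<^sub>v) As x"
  using assms
proof (induction As)
  case (Cons A As)
  have "mprod m As \<in> carrier_mat (2 ^ m) (2 ^ m)" using Cons.prems by (intro mprod_carrier) auto
  then have "mprod m (A # As) *\<^sub>v x = A *\<^sub>v (mprod m As *\<^sub>v x)"
    using Cons.prems assoc_mult_mat_vec[of A "2 ^ m" "2 ^ m" "mprod m As" "2 ^ m" x] by (simp add: mprod_def)
  then show ?case using Cons by simp
qed (simp add: mprod_def)

lemma mprod_append:
  assumes "set As \<subseteq> carrier_mat (2 ^ m) (2 ^ m)" "set Bs \<subseteq> carrier_mat (2 ^ m) (2 ^ m)"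
  shows "mprod m (As @ Bs) = mprod m As * mprod m Bs"
  using assms(1)
proof (induction As)
  case Nil
  then show ?case using mprod_carrier[OF assms(2)] by (simp add: mprod_def)
next
  case (Cons A As)
  then have A: "A \<in> carrier_mat (2 ^ m) (2 ^ m)" and "mprod m (As @ Bs) = mprod m As * mprod m Bs"
    and As: "mprod m As \<in> carrier_mat (2 ^ m) (2 ^ m)" using mprod_carrier[of As m] by auto
  then show ?case using assoc_mult_mat[OF A As mprod_carrier[OF assms(2)]] by (simp add: mprod_def)
qed

lemma dim_mat_adjoint [simp]:
  "dim_row (mat_adjoint A) = dim_col A" "dim_col (mat_adjoint A) = dim_row A"
  by (simp_all add: mat_adjoint_def)

lemma index_mat_adjoint [simp]:
  "i < dim_col A \<Longrightarrow> j < dim_row A \<Longrightarrow> mat_adjoint (A :: complex mat) $$ (i, j) = cnj (A $$ (j, i))"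
  by (simp add: mat_adjoint_def mat_of_rows_def conjugate_complex_def)

lemma mat_adjoint_carrier: "A \<in> carrier_mat k l \<Longrightarrow> mat_adjoint A \<in> carrier_mat l k"
  by (rule carrier_matI) (simp_all only: dim_mat_adjoint carrier_matD)

lemma mat_adjoint_one: "mat_adjoint (1\<^sub>m k :: complex mat) = 1\<^sub>m k"
  by (rule eq_matI) auto

lemma mat_adjoint_mult:
  fixes A B :: "complex mat"
  assumes "A \<in> carrier_mat k l" "B \<in> carrier_mat l m"
  shows "mat_adjoint (A * B) = mat_adjoint B * mat_adjoint A"
  using assms by (intro eq_matI) (auto simp: scalar_prod_def mult.commute intro!: sum.cong)

lemma mat_adjoint_mprod:
  assumes "set As \<subseteq> carrier_mat (2 ^ m) (2 ^ m)"
  shows "mat_adjoint (mprod m As) = mprod m (rev (map mat_adjoint As))"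
  using assms
proof (induction As)
  case (Cons A As)
  then have A: "A \<in> carrier_mat (2 ^ m) (2 ^ m)" and As: "set As \<subseteq> carrier_mat (2 ^ m) (2 ^ m)" by auto
  have c: "set (rev (map mat_adjoint As)) \<subseteq> carrier_mat (2 ^ m) (2 ^ m)"
    using As by (auto intro: mat_adjoint_carrier)
  have "mat_adjoint (mprod m (A # As)) = mat_adjoint (mprod m As) * mat_adjoint A"
    using mat_adjoint_mult[OF A mprod_carrier[OF As]] by (simp add: mprod_def)
  also have "\<dots> = mprod m (rev (map mat_adjoint As)) * mprod m [mat_adjoint A]"
    using Cons.IH[OF As] right_mult_one_mat[OF mat_adjoint_carrier[OF A]] by (simp add: mprod_def)
  finally show ?case using mprod_append[OF c, of "[mat_adjoint A]"] mat_adjoint_carrier[OF A] by simp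
qed (simp add: mprod_def mat_adjoint_one)

section \<open>Reading and overwriting a register inside a basis index\<close>

lemma length_bits_of [simp]: "length (bits_of m i) = m"
  by (simp add: bits_of_def)

lemma bits_of_val_of: "bits_of (length bs) (val_of bs) = bs"
  by (rule nth_equalityI) (auto simp: bits_of_def val_of_def bit_horner_sum_bit_iff rev_nth)

lemma bits_of_eqI:
  assumes "r < 2 ^ N" "s < 2 ^ N" "\<And>q. q < N \<Longrightarrow> bits_of N r ! q = bits_of N s ! q"
  shows "r = s"
proof -
  have "bits_of N r = bits_of N s" using assms(3) by (intro nth_equalityI) auto
  then show ?thesis using assms by (metis val_of_bits_of)
qed

definition reg_val :: "nat \<Rightarrow> nat list \<Rightarrow> nat \<Rightarrow> nat" where
  "reg_val N qs r = val_of (map ((!) (bits_of N r)) qs)"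

text \<open>The new bits are looked up in an association list, so \<open>qs\<close> may be any list
  of qubits, neither contiguous nor ascending. Together with \<open>reg_val\<close> this replaces a
  factorization of the space into the register and the rest.\<close>

definition reg_upd :: "nat \<Rightarrow> nat list \<Rightarrow> nat \<Rightarrow> nat \<Rightarrow> nat" where
  "reg_upd N qs r j = val_of (map (\<lambda>q. case map_of (zip qs (bits_of (length qs) j)) q of
     None \<Rightarrow> bits_of N r ! q | Some b \<Rightarrow> b) [0..<N])"

lemma on_qubits_carrier: "on_qubits N qs U \<in> carrier_mat (2 ^ N) (2 ^ N)"
  by (simp add: on_qubits_def)

lemma reg_val_less: "reg_val N qs r < 2 ^ length qs"
  using val_of_less[of "map ((!) (bits_of N r)) qs"] by (simp add: reg_val_def)

lemma reg_upd_less: "reg_upd N qs r j < 2 ^ N"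
proof -
  have "val_of bs < 2 ^ N" if "length bs = N" for bs
    using that val_of_less[of bs] by simp
  then show ?thesis by (simp add: reg_upd_def)
qed

lemma nth_bits_of_reg_upd:
  assumes "q < N"
  shows "bits_of N (reg_upd N qs r j) ! q =
    (case map_of (zip qs (bits_of (length qs) j)) q of None \<Rightarrow> bits_of N r ! q | Some b \<Rightarrow> b)"
proof -
  have "bits_of N (val_of (map f [0..<N])) = map f [0..<N]" for f
    using bits_of_val_of[of "map f [0..<N]"] by simp
  then show ?thesis using assms by (simp add: reg_upd_def cong: option.case_cong)
qed

lemma nth_bits_of_reg_upd_other:
  assumes "q < N" "q \<notin> set qs"
  shows "bits_of N (reg_upd N qs r j) ! q = bits_of N r ! q"
proof -
  have "map_of (zip qs (bits_of (length qs) j)) q = None"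
    using assms(2) by (simp add: map_of_zip_is_None)
  with assms(1) show ?thesis by (simp only: nth_bits_of_reg_upd option.case)
qed

text \<open>Distinctness matters: for a repeated qubit \<open>map_of\<close> would keep only the
  first of its bits.\<close>

lemma reg_bits_reg_upd:
  assumes "distinct qs" "set qs \<subseteq> {..<N}"
  shows "map ((!) (bits_of N (reg_upd N qs r j))) qs = bits_of (length qs) j"
proof (rule nth_equalityI)
  fix i assume "i < length (map ((!) (bits_of N (reg_upd N qs r j))) qs)"
  then have i: "i < length qs" by simp
  then have "qs ! i < N" using assms nth_mem by blast
  then show "map ((!) (bits_of N (reg_upd N qs r j))) qs ! i = bits_of (length qs) j ! i"
    using i map_of_zip_nth[of qs "bits_of (length qs) j" i] assms(1) by (simp add: nth_bits_of_reg_upd)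
qed simp

lemma reg_val_reg_upd:
  assumes "distinct qs" "set qs \<subseteq> {..<N}" "j < 2 ^ length qs"
  shows "reg_val N qs (reg_upd N qs r j) = j"
  by (simp add: reg_val_def reg_bits_reg_upd assms val_of_bits_of)

lemma reg_val_eq_iff:
  "reg_val N qs r = reg_val N qs s \<longleftrightarrow> (\<forall>q\<in>set qs. bits_of N r ! q = bits_of N s ! q)"
proof
  assume "reg_val N qs r = reg_val N qs s"
  then have "map ((!) (bits_of N r)) qs = map ((!) (bits_of N s)) qs"
    by (metis reg_val_def bits_of_val_of length_map)
  then show "\<forall>q\<in>set qs. bits_of N r ! q = bits_of N s ! q" by simp
qed (simp add: reg_val_def cong: map_cong)

text \<open>An index is determined by its bits on the register and off it. This uniqueness yields
  the later identities between updates without another look at the association list.\<close>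

lemma reg_upd_eqI:
  assumes "distinct qs" "set qs \<subseteq> {..<N}" "s < 2 ^ N" "j < 2 ^ length qs" "reg_val N qs s = j"
    and "\<And>q. q < N \<Longrightarrow> q \<notin> set qs \<Longrightarrow> bits_of N s ! q = bits_of N r ! q"
  shows "reg_upd N qs r j = s"
proof (rule bits_of_eqI[OF reg_upd_less assms(3)])
  fix q assume q: "q < N"
  have "reg_val N qs (reg_upd N qs r j) = reg_val N qs s"
    using assms reg_val_reg_upd by simp
  then show "bits_of N (reg_upd N qs r j) ! q = bits_of N s ! q"
    using q assms(6) by (cases "q \<in> set qs") (simp_all add: reg_val_eq_iff nth_bits_of_reg_upd_other)
qed

lemma reg_upd_twice:
  assumes "distinct qs" "set qs \<subseteq> {..<N}" "k < 2 ^ length qs"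
  shows "reg_upd N qs (reg_upd N qs r j) k = reg_upd N qs r k"
  by (rule reg_upd_eqI) (use assms in \<open>simp_all add: reg_upd_less reg_val_reg_upd nth_bits_of_reg_upd_other\<close>)

lemma reg_val_reg_upd_disjoint:
  assumes "set qs \<subseteq> {..<N}" "set qs \<inter> set ps = {}"
  shows "reg_val N qs (reg_upd N ps r j) = reg_val N qs r"
  using assms by (subst reg_val_eq_iff) (auto intro!: nth_bits_of_reg_upd_other)

lemma reg_upd_commute:
  assumes "distinct qs" "set qs \<subseteq> {..<N}" "distinct ps" "set ps \<subseteq> {..<N}" "set qs \<inter> set ps = {}"
    and j: "j < 2 ^ length qs" "k < 2 ^ length ps"
  shows "reg_upd N qs (reg_upd N ps r k) j = reg_upd N ps (reg_upd N qs r j) k"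
proof (rule reg_upd_eqI)
  show "reg_val N qs (reg_upd N ps (reg_upd N qs r j) k) = j"
    using assms by (simp add: reg_val_reg_upd_disjoint reg_val_reg_upd)
  fix q assume q: "q < N" "q \<notin> set qs"
  have "reg_val N ps (reg_upd N ps (reg_upd N qs r j) k) = reg_val N ps (reg_upd N ps r k)"
    using assms by (simp add: reg_val_reg_upd)
  then show "bits_of N (reg_upd N ps (reg_upd N qs r j) k) ! q = bits_of N (reg_upd N ps r k) ! q"
    using q by (cases "q \<in> set ps") (auto simp: reg_val_eq_iff nth_bits_of_reg_upd_other)
qed (use assms reg_upd_less in auto)

section \<open>Action of an operator on a register\<close>

text \<open>Row \<open>r\<close> can be nonzero only in columns that agree with \<open>r\<close> off
  the register, and these are the indices \<open>reg_upd N qs r j\<close>, one for each content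
  \<open>j\<close>. So a sum over all columns shrinks to a sum over register contents.\<close>

lemma on_qubits_mult_vec:
  assumes qs: "distinct qs" "set qs \<subseteq> {..<N}" and r: "r < 2 ^ N" and x: "x \<in> carrier_vec (2 ^ N)"
  shows "(on_qubits N qs U *\<^sub>v x) $ r =
    (\<Sum>j<2 ^ length qs. U $$ (reg_val N qs r, j) * x $ (reg_upd N qs r j))"
proof -
  let ?agree = "\<lambda>c. \<forall>q<N. q \<notin> set qs \<longrightarrow> bits_of N r ! q = bits_of N c ! q"
  have "(on_qubits N qs U *\<^sub>v x) $ r = (\<Sum>c<2^N. (if ?agree c then U $$ (reg_val N qs r, reg_val N qs c) else 0) * x $ c)"
    using r x by (simp add: on_qubits_def scalar_prod_def lessThan_atLeast0 reg_val_def cong: if_cong)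
  also have "\<dots> = (\<Sum>c\<in>{c. c < 2 ^ N \<and> ?agree c}. U $$ (reg_val N qs r, reg_val N qs c) * x $ c)"
    by (rule sum.mono_neutral_cong_right) auto
  also have "\<dots> = (\<Sum>j<2 ^ length qs. U $$ (reg_val N qs r, j) * x $ (reg_upd N qs r j))"
  proof (rule sum.reindex_bij_witness[where i = "reg_upd N qs r" and j = "reg_val N qs"])
    fix c assume c: "c \<in> {c. c < 2 ^ N \<and> ?agree c}"
    show *: "reg_upd N qs r (reg_val N qs c) = c"
      using c qs reg_val_less by (intro reg_upd_eqI) auto
    show "reg_val N qs c \<in> {..<2 ^ length qs}" by (simp add: reg_val_less)
    show "U $$ (reg_val N qs r, reg_val N qs c) * x $ reg_upd N qs r (reg_val N qs c) =
      U $$ (reg_val N qs r, reg_val N qs c) * x $ c" by (simp add: *)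
  qed (use qs in \<open>auto simp: reg_upd_less reg_val_reg_upd nth_bits_of_reg_upd_other\<close>)
  finally show ?thesis .
qed

lemma on_qubits_mult_vec_carrier: "on_qubits N qs U *\<^sub>v x \<in> carrier_vec (2 ^ N)"
  by (rule carrier_vecI) (simp add: on_qubits_def)

text \<open>The second update of the same register erases the first one, so the intermediate content
  \<open>j\<close> survives only as the summation index of the matrix product
  \<open>U * V\<close>.\<close>

lemma on_qubits_mult:
  assumes qs: "distinct qs" "set qs \<subseteq> {..<N}" and x: "x \<in> carrier_vec (2 ^ N)"
    and U: "U \<in> carrier_mat (2 ^ length qs) (2 ^ length qs)" "V \<in> carrier_mat (2 ^ length qs) (2 ^ length qs)"
  shows "on_qubits N qs U *\<^sub>v (on_qubits N qs V *\<^sub>v x) = on_qubits N qs (U * V) *\<^sub>v x"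
proof (rule eq_vecI)
  fix r assume "r < dim_vec (on_qubits N qs (U * V) *\<^sub>v x)"
  then have r: "r < 2 ^ N" by (simp add: on_qubits_def)
  let ?v = "reg_val N qs r" and ?n = "2 ^ length qs"
  have "(on_qubits N qs U *\<^sub>v (on_qubits N qs V *\<^sub>v x)) $ r =
    (\<Sum>j<?n. \<Sum>k<?n. U $$ (?v, j) * V $$ (j, k) * x $ (reg_upd N qs r k))"
    using qs x r by (simp add: on_qubits_mult_vec on_qubits_mult_vec_carrier reg_upd_less
        reg_val_reg_upd reg_upd_twice sum_distrib_left mult.assoc)
  also have "\<dots> = (\<Sum>k<?n. (\<Sum>j<?n. U $$ (?v, j) * V $$ (j, k)) * x $ (reg_upd N qs r k))"
    by (subst sum.swap) (simp add: sum_distrib_right)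
  also have "\<dots> = (on_qubits N qs (U * V) *\<^sub>v x) $ r"
    using U qs x r reg_val_less[of N qs r]
    by (simp add: on_qubits_mult_vec scalar_prod_def lessThan_atLeast0)
  finally show "(on_qubits N qs U *\<^sub>v (on_qubits N qs V *\<^sub>v x)) $ r = (on_qubits N qs (U * V) *\<^sub>v x) $ r" .
qed (simp add: on_qubits_def)

text \<open>Updates of disjoint registers commute and neither changes the value read from the other
  register, so both orders lead to the same double sum.\<close>

lemma on_qubits_commute:
  assumes qs: "distinct qs" "set qs \<subseteq> {..<N}" "distinct ps" "set ps \<subseteq> {..<N}" "set qs \<inter> set ps = {}"
    and x: "x \<in> carrier_vec (2 ^ N)"
  shows "on_qubits N qs U *\<^sub>v (on_qubits N ps V *\<^sub>v x) = on_qubits N ps V *\<^sub>v (on_qubits N qs U *\<^sub>v x)"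
proof (rule eq_vecI)
  fix r assume "r < dim_vec (on_qubits N ps V *\<^sub>v (on_qubits N qs U *\<^sub>v x))"
  then have r: "r < 2 ^ N" by (simp add: on_qubits_def)
  have ps: "set ps \<inter> set qs = {}" using qs by auto
  have "(on_qubits N qs U *\<^sub>v (on_qubits N ps V *\<^sub>v x)) $ r = (\<Sum>j<2 ^ length qs. \<Sum>k<2 ^ length ps.
      U $$ (reg_val N qs r, j) * (V $$ (reg_val N ps r, k) * x $ (reg_upd N ps (reg_upd N qs r j) k)))"
    using qs x r ps by (simp add: on_qubits_mult_vec on_qubits_mult_vec_carrier reg_upd_less
        reg_val_reg_upd_disjoint sum_distrib_left)
  also have "\<dots> = (\<Sum>k<2 ^ length ps. \<Sum>j<2 ^ length qs.
      V $$ (reg_val N ps r, k) * (U $$ (reg_val N qs r, j) * x $ (reg_upd N qs (reg_upd N ps r k) j)))"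
    by (subst sum.swap) (intro sum.cong refl, use qs in \<open>simp add: reg_upd_commute\<close>)
  also have "\<dots> = (on_qubits N ps V *\<^sub>v (on_qubits N qs U *\<^sub>v x)) $ r"
    using qs x r ps by (simp add: on_qubits_mult_vec on_qubits_mult_vec_carrier reg_upd_less
        reg_val_reg_upd_disjoint sum_distrib_left)
  finally show "(on_qubits N qs U *\<^sub>v (on_qubits N ps V *\<^sub>v x)) $ r =
    (on_qubits N ps V *\<^sub>v (on_qubits N qs U *\<^sub>v x)) $ r" .
qed (simp add: on_qubits_def)

lemma mat_adjoint_on_qubits:
  assumes "U \<in> carrier_mat (2 ^ length qs) (2 ^ length qs)"
  shows "mat_adjoint (on_qubits N qs U) = on_qubits N qs (mat_adjoint U)"
  using assms reg_val_less[of N qs]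
  by (intro eq_matI) (auto simp: on_qubits_def reg_val_def)

lemma controlled_carrier: "U \<in> carrier_mat (2 ^ k) (2 ^ k) \<Longrightarrow> controlled U \<in> carrier_mat (2 ^ Suc k) (2 ^ Suc k)"
  by (auto simp: controlled_def Let_def mult_2)

lemma mat_adjoint_controlled:
  "U \<in> carrier_mat k k \<Longrightarrow> mat_adjoint (controlled U) = controlled (mat_adjoint U)"
  by (intro eq_matI) (auto simp: controlled_def Let_def)

section \<open>Vectors with some qubits in |0>\<close>

text \<open>The subspace in which the qubits of \<open>Q\<close> are in |0>, given by its support so
  that no tensor factor has to be split off and the remaining qubits may be entangled.\<close>

definition zero_on :: "nat \<Rightarrow> nat set \<Rightarrow> complex vec set" where
  "zero_on N Q = {x \<in> carrier_vec (2 ^ N). \<forall>r<2 ^ N. x $ r \<noteq> 0 \<longrightarrow> (\<forall>q\<in>Q. \<not> bits_of N r ! q)}"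

lemma on_qubits_zero_on:
  assumes "distinct qs" "set qs \<subseteq> {..<N}" "Q \<subseteq> {..<N}" "set qs \<inter> Q = {}" "x \<in> zero_on N Q"
  shows "on_qubits N qs U *\<^sub>v x \<in> zero_on N Q"
proof -
  have x: "x \<in> carrier_vec (2 ^ N)" using assms by (simp add: zero_on_def)
  have "\<not> bits_of N r ! q" if r: "r < 2 ^ N" "(on_qubits N qs U *\<^sub>v x) $ r \<noteq> 0" and q: "q \<in> Q" for r q
  proof -
    \<comment> \<open>A nonzero amplitude at \<open>r\<close> needs a nonzero one at some index that
      differs from \<open>r\<close> only on \<open>qs\<close>, hence not on
      \<open>Q\<close>.\<close>
    obtain j where "x $ (reg_upd N qs r j) \<noteq> 0"
      using r x assms by (auto simp: on_qubits_mult_vec elim!: sum.not_neutral_contains_not_neutral)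
    then have "\<not> bits_of N (reg_upd N qs r j) ! q"
      using assms q reg_upd_less by (auto simp: zero_on_def)
    moreover have "q < N" "q \<notin> set qs" using assms q by auto
    ultimately show ?thesis by (simp add: nth_bits_of_reg_upd_other)
  qed
  then show ?thesis by (simp add: zero_on_def on_qubits_mult_vec_carrier)
qed

lemma reg_val_eq_0_iff: "reg_val N qs r = 0 \<longleftrightarrow> (\<forall>q\<in>set qs. \<not> bits_of N r ! q)"
  unfolding reg_val_def by (induction qs) auto

text \<open>The only knowledge about \<open>V\<close> is its column 0, and the support of
  \<open>x\<close> ensures that no other column is met.\<close>

lemma on_qubits_fix_zero:
  assumes qs: "distinct qs" "set qs \<subseteq> {..<N}" and x: "x \<in> zero_on N (set qs)"
    and V: "V \<in> carrier_mat (2 ^ length qs) (2 ^ length qs)"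
    and fix0: "V *\<^sub>v unit_vec (2 ^ length qs) 0 = unit_vec (2 ^ length qs) 0"
  shows "on_qubits N qs V *\<^sub>v x = x"
proof (rule eq_vecI)
  have xc: "x \<in> carrier_vec (2 ^ N)" using x by (simp add: zero_on_def)
  show "dim_vec (on_qubits N qs V *\<^sub>v x) = dim_vec x" using xc by (simp add: on_qubits_def)
  fix r assume "r < dim_vec x"
  then have r: "r < 2 ^ N" using xc by simp
  let ?n = "2 ^ length qs :: nat" and ?v = "reg_val N qs r"
  have col: "V $$ (i, 0) = of_bool (i = 0)" if "i < ?n" for i
  proof -
    have "V $$ (i, 0) = (V *\<^sub>v unit_vec ?n 0) $ i" using that V by simp
    then show ?thesis using that by (simp add: fix0)
  qed
  have zero: "x $ s = 0" if "s < 2 ^ N" "reg_val N qs s \<noteq> 0" for s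
    using x that by (auto simp: zero_on_def reg_val_eq_0_iff)
  have "(on_qubits N qs V *\<^sub>v x) $ r = (\<Sum>j<?n. V $$ (?v, j) * x $ (reg_upd N qs r j))"
    using qs r xc by (simp add: on_qubits_mult_vec)
  also have "\<dots> = (\<Sum>j\<in>{0}. V $$ (?v, j) * x $ (reg_upd N qs r j))"
    using qs by (intro sum.mono_neutral_right) (auto simp: zero reg_upd_less reg_val_reg_upd)
  also have "\<dots> = of_bool (?v = 0) * x $ (reg_upd N qs r 0)"
    by (simp add: col reg_val_less)
  \<comment> \<open>If the register of \<open>r\<close> reads 0, overwriting it with 0 gives
    \<open>r\<close> back; otherwise both sides vanish.\<close>
  also have "\<dots> = x $ r"
    using qs r zero[OF r] reg_upd_eqI[of qs N r 0 r] by (cases "?v = 0") auto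
  finally show "(on_qubits N qs V *\<^sub>v x) $ r = x $ r" .
qed

section \<open>Controlled operators\<close>

text \<open>The control is the head of the list, so it is the top bit of the register value and
  selects the block of \<open>controlled U\<close>. If the control bits of \<open>r\<close> and
  \<open>c\<close> differ, both sides are 0.\<close>

lemma index_on_qubits_controlled:
  assumes "q < N" "q \<notin> set qs" "U \<in> carrier_mat (2 ^ length qs) (2 ^ length qs)" "r < 2 ^ N" "c < 2 ^ N"
  shows "on_qubits N (q # qs) (controlled U) $$ (r, c) =
    (if bits_of N r ! q then on_qubits N qs U $$ (r, c) else of_bool (r = c))"
proof -
  define agree where "agree qs \<longleftrightarrow> (\<forall>q<N. q \<notin> set qs \<longrightarrow> bits_of N r ! q = bits_of N c ! q)" for qs
  \<comment> \<open>Taking \<open>q\<close> off the list adds exactly one agreement condition, the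
    one at \<open>q\<close>.\<close>
  have agree: "agree qs \<longleftrightarrow> agree (q # qs) \<and> bits_of N r ! q = bits_of N c ! q"
    unfolding agree_def using assms(1,2) by (metis list.set_intros(1,2) set_ConsD)
  have eq: "agree qs \<and> reg_val N qs r = reg_val N qs c \<longleftrightarrow> r = c"
  proof
    assume "agree qs \<and> reg_val N qs r = reg_val N qs c"
    then show "r = c"
      unfolding agree_def reg_val_eq_iff by (intro bits_of_eqI[OF assms(4,5)]) blast
  qed (simp add: agree_def)
  have less: "reg_val N qs s < 2 ^ length qs" for s by (rule reg_val_less)
  have val: "reg_val N (q # qs) s = of_bool (bits_of N s ! q) * 2 ^ length qs + reg_val N qs s" for s
    by (simp add: reg_val_def)
  have idx: "on_qubits N ps V $$ (r, c) = (if agree ps then V $$ (reg_val N ps r, reg_val N ps c) else 0)" for ps V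
    using assms(4,5) by (simp add: on_qubits_def reg_val_def agree_def cong: if_cong)
  have ctrl: "controlled U $$ (reg_val N (q # qs) r, reg_val N (q # qs) c) =
     (if bits_of N r ! q = bits_of N c ! q then
       if bits_of N r ! q then U $$ (reg_val N qs r, reg_val N qs c) else of_bool (reg_val N qs r = reg_val N qs c)
      else 0)"
    using assms(3) less[of r] less[of c] by (auto simp: controlled_def Let_def val)
  show ?thesis unfolding idx ctrl using agree eq by (cases "agree qs") auto
qed

lemma on_qubits_controlled_mult_vec:
  assumes "q < N" "q \<notin> set qs" "U \<in> carrier_mat (2 ^ length qs) (2 ^ length qs)" "r < 2 ^ N"
    and "x \<in> carrier_vec (2 ^ N)"
  shows "(on_qubits N (q # qs) (controlled U) *\<^sub>v x) $ r =
    (if bits_of N r ! q then (on_qubits N qs U *\<^sub>v x) $ r else x $ r)"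
proof -
  have *: "(M *\<^sub>v x) $ r = (\<Sum>c<2^N. M $$ (r, c) * x $ c)" if "M \<in> carrier_mat (2 ^ N) (2 ^ N)" for M
    using that assms by (simp add: scalar_prod_def lessThan_atLeast0)
  have "(\<Sum>c<2^N. of_bool (r = c) * x $ c) = x $ r"
    using assms(4) by (subst sum.cong[OF refl, of _ _ "\<lambda>c. if r = c then x $ c else 0"]) auto
  then show ?thesis using assms by (simp add: * on_qubits_carrier index_on_qubits_controlled)
qed

text \<open>The control qubit of \<open>x\<close> may be in superposition. The identity is checked
  row by row, because each row has a definite control bit.\<close>

lemma on_qubits_absorb_control:
  assumes q: "q < N" "q \<notin> set qs" and qs: "distinct qs" "set qs \<subseteq> {..<N}"
    and V: "V \<in> carrier_mat (2 ^ length qs) (2 ^ length qs)" and A: "A \<in> carrier_mat (2 ^ length qs) (2 ^ length qs)"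
    and fix0: "V *\<^sub>v unit_vec (2 ^ length qs) 0 = unit_vec (2 ^ length qs) 0"
    and x: "x \<in> zero_on N (set qs)"
  shows "on_qubits N qs V *\<^sub>v (on_qubits N (q # qs) (controlled A) *\<^sub>v x) =
    on_qubits N (q # qs) (controlled (V * A)) *\<^sub>v x"
proof (rule eq_vecI)
  have xc: "x \<in> carrier_vec (2 ^ N)" using x by (simp add: zero_on_def)
  fix r assume "r < dim_vec (on_qubits N (q # qs) (controlled (V * A)) *\<^sub>v x)"
  then have r: "r < 2 ^ N" by (simp add: on_qubits_def)
  \<comment> \<open>For a fixed row \<open>r\<close> the control is frozen:
    \<open>reg_upd N qs r j\<close> never touches \<open>q\<close>, so at all indices that enter
    this row the controlled gate acts as one and the same uncontrolled operator.\<close>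
  let ?y = "if bits_of N r ! q then on_qubits N qs A *\<^sub>v x else x"
  have y: "?y \<in> carrier_vec (2 ^ N)" using xc on_qubits_mult_vec_carrier by simp
  have "(on_qubits N (q # qs) (controlled A) *\<^sub>v x) $ reg_upd N qs r j = ?y $ reg_upd N qs r j" for j
    using q A xc by (simp add: on_qubits_controlled_mult_vec reg_upd_less nth_bits_of_reg_upd_other)
  then have "(on_qubits N qs V *\<^sub>v (on_qubits N (q # qs) (controlled A) *\<^sub>v x)) $ r = (on_qubits N qs V *\<^sub>v ?y) $ r"
    unfolding on_qubits_mult_vec[OF qs r on_qubits_mult_vec_carrier] on_qubits_mult_vec[OF qs r y] by simp
  also have "\<dots> = (on_qubits N (q # qs) (controlled (V * A)) *\<^sub>v x) $ r"
    using on_qubits_mult[OF qs xc V A] on_qubits_fix_zero[OF qs x V fix0]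
      on_qubits_controlled_mult_vec[OF q mult_carrier_mat[OF V A] r xc] by simp
  finally show "(on_qubits N qs V *\<^sub>v (on_qubits N (q # qs) (controlled A) *\<^sub>v x)) $ r =
    (on_qubits N (q # qs) (controlled (V * A)) *\<^sub>v x) $ r" .
qed (simp add: on_qubits_def)

section \<open>Absorbing one sequence of operators into another\<close>

lemma foldr_closed:
  assumes "\<And>s x. s \<in> set ss \<Longrightarrow> x \<in> D \<Longrightarrow> f s x \<in> D" "x \<in> D"
  shows "foldr f ss x \<in> D"
  using assms by (induction ss) auto

lemma foldr_commute:
  assumes "\<And>s x. s \<in> set ss \<Longrightarrow> x \<in> D \<Longrightarrow> f s x \<in> D"
    and "\<And>s x. s \<in> set ss \<Longrightarrow> x \<in> D \<Longrightarrow> f s (g x) = g (f s x)" "x \<in> D"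
  shows "foldr f ss (g x) = g (foldr f ss x)"
  using assms
proof (induction ss)
  case (Cons s ss)
  have "foldr f ss x \<in> D" by (rule foldr_closed) (use Cons.prems in auto)
  then show ?case using Cons by simp
qed simp

text \<open>\<open>V s\<close>, \<open>C s\<close>, \<open>P s\<close> stand for the plain gate, the
  controlled gate and the controlled product on register \<open>s\<close>, and \<open>Z s\<close>
  for the vectors with this register in |0>. The two lists are ordered independently: to the right
  of the SELECTs the plain gates run in the opposite order to the controlled ones, while the adjoint
  of the left part has both in the same order.\<close>

lemma foldr_absorb:
  fixes V C P :: "'i \<Rightarrow> 'v \<Rightarrow> 'v" and Z :: "'i \<Rightarrow> 'v set"
  assumes closed: "\<And>s x. s \<in> I \<Longrightarrow> x \<in> D \<Longrightarrow> V s x \<in> D" "\<And>s x. s \<in> I \<Longrightarrow> x \<in> D \<Longrightarrow> C s x \<in> D"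
      "\<And>s x. s \<in> I \<Longrightarrow> x \<in> D \<Longrightarrow> P s x \<in> D"
    and commute: "\<And>s t x. s \<in> I \<Longrightarrow> t \<in> I \<Longrightarrow> s \<noteq> t \<Longrightarrow> x \<in> D \<Longrightarrow> V s (C t x) = C t (V s x)"
      "\<And>s t x. s \<in> I \<Longrightarrow> t \<in> I \<Longrightarrow> s \<noteq> t \<Longrightarrow> x \<in> D \<Longrightarrow> V s (P t x) = P t (V s x)"
    and Z: "\<And>s t x. s \<in> I \<Longrightarrow> t \<in> I \<Longrightarrow> s \<noteq> t \<Longrightarrow> x \<in> Z t \<Longrightarrow> V s x \<in> Z t"
      "\<And>s t x. s \<in> I \<Longrightarrow> t \<in> I \<Longrightarrow> s \<noteq> t \<Longrightarrow> x \<in> Z t \<Longrightarrow> C s x \<in> Z t"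
    and absorb: "\<And>s x. s \<in> I \<Longrightarrow> x \<in> Z s \<Longrightarrow> V s (C s x) = P s x"
    and x: "x \<in> D" "\<And>s. s \<in> I \<Longrightarrow> x \<in> Z s"
    and lists: "distinct vs" "distinct cs" "set vs = set cs" "set cs \<subseteq> I"
  shows "foldr V vs (foldr C cs x) = foldr P cs x"
  using lists
proof (induction cs arbitrary: vs)
  case (Cons c cs)
  \<comment> \<open>\<open>C c\<close> is the last controlled gate to act. Its partner
    \<open>V c\<close> may stand anywhere in \<open>vs\<close>; removing it leaves
    \<open>us @ ws\<close> for the induction hypothesis, hence the generalization over
    \<open>vs\<close>.\<close>
  then obtain us ws where vs: "vs = us @ c # ws" by (metis list.set_intros(1) split_list)
  have sets: "set us \<subseteq> I - {c}" "set ws \<subseteq> I - {c}" "set cs \<subseteq> I - {c}" "c \<in> I"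
    "set (us @ ws) = set cs" "distinct (us @ ws)"
    using Cons.prems by (auto simp: vs)
  define z where "z = foldr C cs x"
  define y where "y = foldr V ws z"
  have zD: "z \<in> D" unfolding z_def by (rule foldr_closed) (use sets closed x in auto)
  \<comment> \<open>Neither the remaining controlled gates nor, below, the gates of
    \<open>ws\<close> touch register \<open>c\<close>, so it is still in |0> when \<open>V c\<close>
    meets \<open>C c\<close>.\<close>
  have zZ: "z \<in> Z c" unfolding z_def by (rule foldr_closed) (use sets Z(2) x in blast)+
  have yD: "y \<in> D" unfolding y_def by (rule foldr_closed) (use sets closed zD in auto)
  have yZ: "y \<in> Z c" unfolding y_def by (rule foldr_closed) (use sets Z(1) zZ in blast)+
  have "foldr V ws (C c z) = C c y"
    unfolding y_def by (rule foldr_commute[where D = D and f = V, OF _ commute(1) zD]) (use sets closed in blast)+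
  then have "foldr V vs (foldr C (c # cs) x) = foldr V us (P c y)"
    using absorb[OF sets(4) yZ] by (simp add: vs z_def)
  also have "\<dots> = P c (foldr V us y)"
    by (rule foldr_commute[where D = D and f = V, OF _ commute(2) yD]) (use sets closed in blast)+
  also have "foldr V us y = foldr P cs x"
    using Cons.IH[of "us @ ws"] Cons.prems sets by (simp add: y_def z_def)
  finally show ?case by simp
qed simp

section \<open>The inner registers of the circuit\<close>

lemma zero_on_mono: "x \<in> zero_on N Q \<Longrightarrow> R \<subseteq> Q \<Longrightarrow> x \<in> zero_on N R"
  by (auto simp: zero_on_def)

lemma inner_reg_props:
  assumes "s \<in> {1..d}"
  shows "distinct (inner_reg n d s)" "length (inner_reg n d s) = 2 * n"
    and "set (inner_reg n d s) \<subseteq> {d..<d + 2 * d * n}"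
    and "set (inner_reg n d s) \<subseteq> {..<total_qubits n d}"
    and "t \<in> {1..d} \<Longrightarrow> t - 1 < total_qubits n d"
    and "t \<in> {1..d} \<Longrightarrow> t - 1 \<notin> set (inner_reg n d s)"
proof -
  \<comment> \<open>\<open>s - 1\<close> is truncated subtraction; numbering from 1 gives every
    register its full \<open>2 * n\<close> qubits.\<close>
  have s: "2 * n * s = 2 * n * (s - 1) + 2 * n" using assms by (cases s) auto
  have "2 * n * s \<le> 2 * n * d" using assms by (intro mult_left_mono) auto
  then have "2 * n * s \<le> 2 * d * n" by (simp add: mult.commute mult.left_commute)
  then show "set (inner_reg n d s) \<subseteq> {d..<d + 2 * d * n}" by (auto simp: inner_reg_def)
  then show "set (inner_reg n d s) \<subseteq> {..<total_qubits n d}"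
    by (rule order_trans) (auto simp: total_qubits_def)
  show "distinct (inner_reg n d s)" "length (inner_reg n d s) = 2 * n"
    unfolding inner_reg_def s by simp_all
  show "t \<in> {1..d} \<Longrightarrow> t - 1 < total_qubits n d" by (auto simp: total_qubits_def)
  show "t \<in> {1..d} \<Longrightarrow> t - 1 \<notin> set (inner_reg n d s)" by (auto simp: inner_reg_def)
qed

lemma inner_reg_disjoint:
  assumes "s \<in> {1..d}" "t \<in> {1..d}" "s \<noteq> t"
  shows "set (inner_reg n d s) \<inter> set (inner_reg n d t) = {}"
proof -
  have *: "set (inner_reg n d s) \<inter> set (inner_reg n d t) = {}" if "s < t" for s t
  proof -
    have "2 * n * s \<le> 2 * n * (t - 1)" using that by (intro mult_left_mono) auto
    then show ?thesis by (auto simp: inner_reg_def)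
  qed
  show ?thesis using assms(3) *[of s t] *[of t s] by (cases "s < t") auto
qed

lemma on_inner_absorbs_ctrl_inner:
  assumes V: "V \<in> carrier_mat (2 ^ (2 * n)) (2 ^ (2 * n))" and A: "A \<in> carrier_mat (2 ^ (2 * n)) (2 ^ (2 * n))"
    and fix0: "V *\<^sub>v ket (2 * n) 0 = ket (2 * n) 0"
    and x: "x \<in> zero_on (total_qubits n d) {d..<d + 2 * d * n}"
    and lists: "distinct vs" "distinct cs" "set vs = set cs" "set cs \<subseteq> {1..d}"
  defines "N \<equiv> total_qubits n d"
  shows "mprod N (map (\<lambda>s. on_inner n d s V) vs) *\<^sub>v (mprod N (map (\<lambda>s. ctrl_inner n d s A) cs) *\<^sub>v x) =
    mprod N (map (\<lambda>s. ctrl_inner n d s (V * A)) cs) *\<^sub>v x"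
proof -
  let ?R = "\<lambda>s. set (inner_reg n d s)"
  note props = inner_reg_props[where d = d and n = n, folded N_def]
  have xc: "x \<in> carrier_vec (2 ^ N)" using x by (simp add: zero_on_def N_def)
  have ctrl_reg: "distinct ((s - 1) # inner_reg n d s)" "set ((s - 1) # inner_reg n d s) \<subseteq> {..<N}"
    if "s \<in> {1..d}" for s
    using props(1,4)[OF that] props(5,6)[OF that that] by auto
  \<comment> \<open>Register \<open>s\<close> must avoid the control qubit \<open>t - 1\<close> as
    well as register \<open>t\<close>; the outer ancillas all lie below \<open>d\<close>.\<close>
  have disjoint: "?R s \<inter> set ((t - 1) # inner_reg n d t) = {}"
    if "s \<in> {1..d}" "t \<in> {1..d}" "s \<noteq> t" for s t
    using inner_reg_disjoint[OF that, of n] props(6)[OF that(1,2)] by auto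
  have "foldr (\<lambda>s. (*\<^sub>v) (on_inner n d s V)) vs (foldr (\<lambda>s. (*\<^sub>v) (ctrl_inner n d s A)) cs x) =
    foldr (\<lambda>s. (*\<^sub>v) (ctrl_inner n d s (V * A))) cs x"
  proof (rule foldr_absorb[where I = "{1..d}" and D = "carrier_vec (2 ^ N)" and Z = "\<lambda>s. zero_on N (?R s)"])
    fix s t y assume st: "s \<in> {1..d}" "t \<in> {1..d}" "s \<noteq> t"
    note on_qubits_commute[OF props(1,4)[OF st(1)] ctrl_reg[OF st(2)] disjoint[OF st]]
    then show "on_inner n d s V *\<^sub>v (ctrl_inner n d t A *\<^sub>v y) = ctrl_inner n d t A *\<^sub>v (on_inner n d s V *\<^sub>v y)"
      "on_inner n d s V *\<^sub>v (ctrl_inner n d t (V * A) *\<^sub>v y) = ctrl_inner n d t (V * A) *\<^sub>v (on_inner n d s V *\<^sub>v y)"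
      if "y \<in> carrier_vec (2 ^ N)"
      using that by (simp_all add: on_inner_def ctrl_inner_def flip: N_def)
    show "on_inner n d s V *\<^sub>v y \<in> zero_on N (?R t)" if "y \<in> zero_on N (?R t)"
      using on_qubits_zero_on[OF props(1,4)[OF st(1)] props(4)[OF st(2)] inner_reg_disjoint[OF st] that]
      by (simp add: on_inner_def flip: N_def)
    show "ctrl_inner n d s A *\<^sub>v y \<in> zero_on N (?R t)" if "y \<in> zero_on N (?R t)"
      using on_qubits_zero_on[OF ctrl_reg[OF st(1)] props(4)[OF st(2)] _ that] disjoint[of t s] st
      by (simp add: ctrl_inner_def Int_commute flip: N_def)
  next
    fix s y assume s: "s \<in> {1..d}" and y: "y \<in> zero_on N (?R s)"
    have "V *\<^sub>v unit_vec (2 ^ (2 * n)) 0 = unit_vec (2 ^ (2 * n)) 0"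
      using fix0 by (simp add: ket_eq)
    then show "on_inner n d s V *\<^sub>v (ctrl_inner n d s A *\<^sub>v y) = ctrl_inner n d s (V * A) *\<^sub>v y"
      using on_qubits_absorb_control[OF props(5,6)[OF s s] props(1,4)[OF s] _ _ _ y, of V A] props(2)[OF s] V A
      by (simp add: on_inner_def ctrl_inner_def flip: N_def)
  next
    fix s assume "s \<in> {1..d}"
    then show "x \<in> zero_on N (?R s)"
      using zero_on_mono[OF x props(3)] by (simp add: N_def)
  qed (use lists xc in \<open>simp_all add: on_inner_def ctrl_inner_def on_qubits_mult_vec_carrier flip: N_def\<close>)
  then have "foldr (*\<^sub>v) (map (\<lambda>s. on_inner n d s V) vs) (foldr (*\<^sub>v) (map (\<lambda>s. ctrl_inner n d s A) cs) x) =
    foldr (*\<^sub>v) (map (\<lambda>s. ctrl_inner n d s (V * A)) cs) x"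
    by (simp add: foldr_map comp_def)
  moreover have c: "set (map (\<lambda>s. on_inner n d s U) ss) \<subseteq> carrier_mat (2 ^ N) (2 ^ N)"
    "set (map (\<lambda>s. ctrl_inner n d s U) ss) \<subseteq> carrier_mat (2 ^ N) (2 ^ N)" for U ss
    by (auto simp: on_inner_def ctrl_inner_def N_def on_qubits_carrier)
  have "mprod N (map (\<lambda>s. ctrl_inner n d s A) cs) *\<^sub>v x \<in> carrier_vec (2 ^ N)"
    using mult_mat_vec_carrier[OF mprod_carrier[OF c(2)] xc] .
  ultimately show ?thesis
    by (simp only: mprod_mult_vec[OF c(1)] mprod_mult_vec[OF c(2) xc])
qed

section \<open>Initialization and post-selection of the ancillas\<close>

text \<open>The system qubits come last and carry the low bits, so all ancillas are 0 exactly for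
  the indices below \<open>2 ^ n\<close>.\<close>

lemma ancilla_init_eq:
  assumes "\<phi> \<in> carrier_vec (2 ^ n)"
  shows "ancilla_init n d \<phi> = vec (2 ^ total_qubits n d) (\<lambda>k. if k < 2 ^ n then \<phi> $ k else 0)"
proof -
  have "vkron (ket d 0) (ket (2 * d * n) 0) = unit_vec (2 ^ (d + 2 * d * n)) 0"
    using vkron_unit_vec[of 0 "2 ^ d" 0 "2 ^ (2 * d * n)"] by (simp add: ket_eq power_add)
  then show ?thesis using assms
    by (intro eq_vecI)
      (auto simp: ancilla_init_def vkron_def total_qubits_def power_add less_mult_imp_div_less div_eq_0_iff)
qed

lemma ancilla_init_zero_on:
  assumes "\<phi> \<in> carrier_vec (2 ^ n)"
  shows "ancilla_init n d \<phi> \<in> zero_on (total_qubits n d) {d..<d + 2 * d * n}"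
proof -
  have "\<not> bits_of (total_qubits n d) r ! q" if r: "r < 2 ^ n" and q: "q \<in> {d..<d + 2 * d * n}" for r q
  proof -
    have "take_bit n r = r" using r by (simp add: take_bit_nat_eq_self)
    moreover have "\<not> total_qubits n d - 1 - q < n" "q < total_qubits n d"
      using q by (auto simp: total_qubits_def)
    ultimately show ?thesis by (simp add: bits_of_def) (metis bit_take_bit_iff)
  qed
  then show ?thesis using assms by (auto simp: zero_on_def ancilla_init_eq split: if_splits)
qed

lemma ancilla_postselect_mult_vec:
  assumes "y \<in> carrier_vec (2 ^ total_qubits n d)"
  shows "ancilla_postselect n d *\<^sub>v y = vec (2 ^ n) (\<lambda>r. y $ r)"
proof (rule eq_vecI)
  define D E :: nat where "D = 2 ^ d" and "E = 2 ^ (2 * d * n)"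
  have N: "2 ^ total_qubits n d = D * E * 2 ^ n"
    by (simp add: D_def E_def total_qubits_def power_add)
  have pos: "0 < D" "0 < E" by (simp_all add: D_def E_def)
  have bra: "bra (ket m 0) = mat 1 (2 ^ m) (\<lambda>(r, c). of_bool (c = 0))" for m
    by (rule eq_matI) (auto simp: bra_def ket_eq mat_of_row_def conjugate_vec_def unit_vec_def)
  have "kron (bra (ket d 0)) (bra (ket (2 * d * n) 0)) = mat 1 (D * E) (\<lambda>(r, c). of_bool (c = 0))"
    unfolding bra D_def[symmetric] E_def[symmetric] using pos
    by (intro eq_matI) (auto simp: kron_def less_mult_imp_div_less div_eq_0_iff)
  then have post: "ancilla_postselect n d = mat (2 ^ n) (2 ^ total_qubits n d) (\<lambda>(r, c). of_bool (c = r))"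
    unfolding N by (intro eq_matI) (auto simp: ancilla_postselect_def kron_def less_mult_imp_div_less div_eq_0_iff)
  show "dim_vec (ancilla_postselect n d *\<^sub>v y) = dim_vec (vec (2 ^ n) (\<lambda>r. y $ r))" by (simp add: post)
  fix r assume "r < dim_vec (vec (2 ^ n) (\<lambda>r. y $ r))"
  then have r: "r < 2 ^ n" by simp
  moreover have "(2::nat) ^ n \<le> 2 ^ total_qubits n d" by (intro power_increasing) (auto simp: total_qubits_def)
  ultimately have rN: "r < 2 ^ total_qubits n d" by linarith
  have "(ancilla_postselect n d *\<^sub>v y) $ r = (\<Sum>c<2 ^ total_qubits n d. of_bool (c = r) * y $ c)"
    using r assms by (simp add: post scalar_prod_def lessThan_atLeast0)
  also have "\<dots> = y $ r" using rN by (subst sum.cong[OF refl, of _ _ "\<lambda>c. if c = r then y $ c else 0"]) auto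
  finally show "(ancilla_postselect n d *\<^sub>v y) $ r = vec (2 ^ n) (\<lambda>r. y $ r) $ r" using r by simp
qed

text \<open>The rows of \<open>ancilla_postselect n d\<close> are the adjoints of the states \<open>ancilla_init n d |k\<rangle>\<close>.\<close>

lemma ancilla_postselect_adjoint_cong:
  assumes M: "M \<in> carrier_mat (2 ^ total_qubits n d) (2 ^ total_qubits n d)"
    "M' \<in> carrier_mat (2 ^ total_qubits n d) (2 ^ total_qubits n d)"
    and eq: "\<And>\<phi>. \<phi> \<in> carrier_vec (2 ^ n) \<Longrightarrow> M *\<^sub>v ancilla_init n d \<phi> = M' *\<^sub>v ancilla_init n d \<phi>"
    and y: "y \<in> carrier_vec (2 ^ total_qubits n d)"
  shows "ancilla_postselect n d *\<^sub>v (mat_adjoint M *\<^sub>v y) = ancilla_postselect n d *\<^sub>v (mat_adjoint M' *\<^sub>v y)"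
proof -
  let ?N = "2 ^ total_qubits n d :: nat"
  have "(mat_adjoint M *\<^sub>v y) $ r = (mat_adjoint M' *\<^sub>v y) $ r" if r: "r < 2 ^ n" for r
  proof -
    have "(2::nat) ^ n \<le> ?N" by (intro power_increasing) (auto simp: total_qubits_def)
    then have rN: "r < ?N" using r by linarith
    \<comment> \<open>By the layout, |r> on the system keeps its index \<open>r\<close> among all
      qubits. Hence \<open>M\<close> and \<open>M'\<close> share column \<open>r\<close>, whose
      conjugate is row \<open>r\<close> of the adjoints, and these are the rows that post-selection
      keeps.\<close>
    have "ancilla_init n d (unit_vec (2 ^ n) r) = unit_vec ?N r"
      using r by (intro eq_vecI) (auto simp: ancilla_init_eq unit_vec_def)
    then have unit: "M *\<^sub>v unit_vec ?N r = M' *\<^sub>v unit_vec ?N r"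
      using eq[of "unit_vec (2 ^ n) r"] by simp
    have "M $$ (c, r) = M' $$ (c, r)" if "c < ?N" for c
      using arg_cong[OF unit, of "\<lambda>v. v $ c"] that rN M by simp
    then show ?thesis using rN M y by (auto simp: scalar_prod_def intro!: sum.cong)
  qed
  then show ?thesis
    using mult_mat_vec_carrier[OF mat_adjoint_carrier[OF M(1)] y] mult_mat_vec_carrier[OF mat_adjoint_carrier[OF M(2)] y]
    by (auto simp: ancilla_postselect_mult_vec)
qed

section \<open>The two sides of the circuit\<close>

text \<open>The adjoint reverses the descending order of the controlled gates, which produces the
  ascending order found to the left of the SELECTs.\<close>

lemma adjoint_preparation:
  fixes U POLY :: "complex mat"
  assumes U: "U \<in> carrier_mat (2 ^ (2 * n)) (2 ^ (2 * n))" and POLY: "POLY \<in> carrier_mat (2 ^ d) (2 ^ d)"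
  defines "N \<equiv> total_qubits n d"
  shows "mat_adjoint (mprod N (map (\<lambda>s. ctrl_inner n d s U) (rev [1..<d + 1])) * on_outer n d POLY) =
    on_outer n d (mat_adjoint POLY) * mprod N (map (\<lambda>s. ctrl_inner n d s (mat_adjoint U)) [1..<d + 1])"
proof -
  have c: "set (map (\<lambda>s. ctrl_inner n d s U) ss) \<subseteq> carrier_mat (2 ^ N) (2 ^ N)" for ss
    by (auto simp: ctrl_inner_def N_def on_qubits_carrier)
  have "mat_adjoint (ctrl_inner n d s U) = ctrl_inner n d s (mat_adjoint U)" if "s \<in> {1..d}" for s
  proof -
    have "length ((s - 1) # inner_reg n d s) = Suc (2 * n)" using inner_reg_props(2)[OF that] by simp
    then show ?thesis
      unfolding ctrl_inner_def using controlled_carrier[OF U] mat_adjoint_controlled[OF U]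
      by (subst mat_adjoint_on_qubits) simp_all
  qed
  then have "map (mat_adjoint \<circ> (\<lambda>s. ctrl_inner n d s U)) [1..<d + 1] =
      map (\<lambda>s. ctrl_inner n d s (mat_adjoint U)) [1..<d + 1]"
    by (intro map_cong) auto
  then have "rev (map mat_adjoint (map (\<lambda>s. ctrl_inner n d s U) (rev [1..<d + 1]))) =
      map (\<lambda>s. ctrl_inner n d s (mat_adjoint U)) [1..<d + 1]"
    by (simp only: rev_map map_map rev_rev_ident)
  moreover have "mat_adjoint (on_outer n d POLY) = on_outer n d (mat_adjoint POLY)"
    unfolding on_outer_def using POLY by (intro mat_adjoint_on_qubits) simp
  moreover have "on_outer n d POLY \<in> carrier_mat (2 ^ N) (2 ^ N)"
    by (simp add: on_outer_def N_def on_qubits_carrier)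
  ultimately show ?thesis
    by (simp only: mat_adjoint_mult[OF mprod_carrier[OF c]] mat_adjoint_mprod[OF c])
qed

lemma mat_adjoint_on_inner_product:
  assumes V: "V \<in> carrier_mat (2 ^ (2 * n)) (2 ^ (2 * n))" and "set ss \<subseteq> {1..d}"
  defines "N \<equiv> total_qubits n d"
  shows "mat_adjoint (mprod N (map (\<lambda>s. on_inner n d s V) (rev ss))) =
    mprod N (map (\<lambda>s. on_inner n d s (mat_adjoint V)) ss)"
proof -
  have c: "set (map (\<lambda>s. on_inner n d s V) (rev ss)) \<subseteq> carrier_mat (2 ^ N) (2 ^ N)"
    by (auto simp: on_inner_def N_def on_qubits_carrier)
  have "mat_adjoint (on_inner n d s V) = on_inner n d s (mat_adjoint V)" if "s \<in> set ss" for s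
    unfolding on_inner_def using V assms(2) that inner_reg_props(2)[of s d n]
    by (intro mat_adjoint_on_qubits) auto
  then have "map (mat_adjoint \<circ> (\<lambda>s. on_inner n d s V)) ss = map (\<lambda>s. on_inner n d s (mat_adjoint V)) ss"
    by (intro map_cong) auto
  then show ?thesis by (simp only: mat_adjoint_mprod[OF c] rev_map map_map rev_rev_ident)
qed

text \<open>\<open>POLY\<close> acts on the outer ancillas alone, so all inner registers are still
  in |0> when the controlled gates begin.\<close>

lemma preparation_absorb:
  assumes V: "V \<in> carrier_mat (2 ^ (2 * n)) (2 ^ (2 * n))" and A: "A \<in> carrier_mat (2 ^ (2 * n)) (2 ^ (2 * n))"
    and fix0: "V *\<^sub>v ket (2 * n) 0 = ket (2 * n) 0" and \<phi>: "\<phi> \<in> carrier_vec (2 ^ n)"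
    and vs: "distinct vs" "set vs = {1..d}"
  defines "N \<equiv> total_qubits n d"
  shows "mprod N (map (\<lambda>s. on_inner n d s V) vs) *\<^sub>v
      (mprod N (map (\<lambda>s. ctrl_inner n d s A) (rev [1..<d + 1])) *\<^sub>v (on_outer n d POLY *\<^sub>v ancilla_init n d \<phi>)) =
    mprod N (map (\<lambda>s. ctrl_inner n d s (V * A)) (rev [1..<d + 1])) *\<^sub>v (on_outer n d POLY *\<^sub>v ancilla_init n d \<phi>)"
  unfolding N_def
proof (rule on_inner_absorbs_ctrl_inner[OF V A fix0])
  show "on_outer n d POLY *\<^sub>v ancilla_init n d \<phi> \<in> zero_on (total_qubits n d) {d..<d + 2 * d * n}"
    unfolding on_outer_def
    by (rule on_qubits_zero_on[OF _ _ _ _ ancilla_init_zero_on[OF \<phi>]]) (auto simp: total_qubits_def)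
  have "set (rev [1..<d + 1]) = {1..d}" by auto
  then show "set vs = set (rev [1..<d + 1])" "set (rev [1..<d + 1]) \<subseteq> {1..d}" using vs by simp_all
qed (use vs in simp_all)

lemma circuit_W_postselect_eq:
  assumes POLY_L: "POLY_L \<in> carrier_mat (2 ^ d) (2 ^ d)"
    and V: "V_R \<in> carrier_mat (2 ^ (2 * n)) (2 ^ (2 * n))" "V_L \<in> carrier_mat (2 ^ (2 * n)) (2 ^ (2 * n))"
    and A: "A_R \<in> carrier_mat (2 ^ (2 * n)) (2 ^ (2 * n))" "A_L \<in> carrier_mat (2 ^ (2 * n)) (2 ^ (2 * n))"
    and fix0: "V_R *\<^sub>v ket (2 * n) 0 = ket (2 * n) 0" "V_L *\<^sub>v ket (2 * n) 0 = ket (2 * n) 0"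
    and \<phi>: "\<phi> \<in> carrier_vec (2 ^ n)"
  shows "ancilla_postselect n d *\<^sub>v (circuit_W n d POLY_R POLY_L (V_R * A_R) (V_L * A_L) *\<^sub>v ancilla_init n d \<phi>) =
    ancilla_postselect n d *\<^sub>v (circuit_W_simplified n d POLY_R POLY_L V_R V_L A_R A_L *\<^sub>v ancilla_init n d \<phi>)"
proof -
  define N where "N = total_qubits n d"
  let ?M = "carrier_mat (2 ^ N) (2 ^ N)" and ?ss = "[1..<d + 1]"
  define ctrl where "ctrl U ss = mprod N (map (\<lambda>s. ctrl_inner n d s U) ss)" for U ss
  define inner where "inner U ss = mprod N (map (\<lambda>s. on_inner n d s U) ss)" for U ss
  define SEL where "SEL = mprod N (map (select_at n d) (rev ?ss))"
  have outer: "on_outer n d U \<in> ?M" for U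
    by (simp add: on_outer_def N_def on_qubits_carrier)
  have ctrl: "ctrl U ss \<in> ?M" for U ss
    unfolding ctrl_def by (rule mprod_carrier) (auto simp: ctrl_inner_def N_def on_qubits_carrier)
  have inner: "inner U ss \<in> ?M" for U ss
    unfolding inner_def by (rule mprod_carrier) (auto simp: on_inner_def N_def on_qubits_carrier)
  have SEL: "SEL \<in> ?M"
    unfolding SEL_def by (rule mprod_carrier) (auto simp: select_at_def N_def on_qubits_carrier)
  note carriers = outer ctrl inner SEL
  have init: "ancilla_init n d \<psi> \<in> carrier_vec (2 ^ N)" if "\<psi> \<in> carrier_vec (2 ^ n)" for \<psi>
    using that by (simp add: ancilla_init_eq N_def)
  have mv: "M *\<^sub>v v \<in> carrier_vec (2 ^ N)" if "M \<in> ?M" "v \<in> carrier_vec (2 ^ N)" for M v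
    using that by (rule mult_mat_vec_carrier)
  have assoc: "(K * M) *\<^sub>v v = K *\<^sub>v (M *\<^sub>v v)" if "K \<in> ?M" "M \<in> ?M" "v \<in> carrier_vec (2 ^ N)" for K M v
    using that by (rule assoc_mult_mat_vec)
  have absorb: "inner V vs *\<^sub>v (ctrl A (rev ?ss) *\<^sub>v (on_outer n d POLY *\<^sub>v ancilla_init n d \<psi>)) =
      ctrl (V * A) (rev ?ss) *\<^sub>v (on_outer n d POLY *\<^sub>v ancilla_init n d \<psi>)"
    if "V \<in> carrier_mat (2 ^ (2 * n)) (2 ^ (2 * n))" "A \<in> carrier_mat (2 ^ (2 * n)) (2 ^ (2 * n))"
      "V *\<^sub>v ket (2 * n) 0 = ket (2 * n) 0" "\<psi> \<in> carrier_vec (2 ^ n)" "distinct vs" "set vs = {1..d}"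
    for V A POLY \<psi> vs
    using preparation_absorb[OF that] by (simp only: inner_def ctrl_def N_def)
  \<comment> \<open>The adjoints of \<open>L\<close> and \<open>L'\<close> are what the two circuits
    apply after the SELECTs.\<close>
  define L where "L = ctrl (V_L * A_L) (rev ?ss) * on_outer n d POLY_L"
  define L' where "L' = inner V_L (rev ?ss) * (ctrl A_L (rev ?ss) * on_outer n d POLY_L)"
  \<comment> \<open>The state after the SELECTs. Once \<open>V_R\<close> is absorbed it is common to
    both circuits, so only the left parts remain to be compared.\<close>
  define y where "y = SEL *\<^sub>v (ctrl (V_R * A_R) (rev ?ss) *\<^sub>v (on_outer n d POLY_R *\<^sub>v ancilla_init n d \<phi>))"
  have yc: "y \<in> carrier_vec (2 ^ N)"
    unfolding y_def by (intro mv carriers init \<phi>)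
  have L: "L \<in> ?M" unfolding L_def by (rule mult_carrier_mat[OF ctrl outer])
  have L': "L' \<in> ?M" unfolding L'_def by (rule mult_carrier_mat[OF inner mult_carrier_mat[OF ctrl outer]])
  have adj_L: "mat_adjoint L = on_outer n d (mat_adjoint POLY_L) * ctrl (mat_adjoint (V_L * A_L)) ?ss"
    unfolding L_def ctrl_def N_def by (rule adjoint_preparation[OF mult_carrier_mat[OF V(2) A(2)] POLY_L])
  have "mat_adjoint (inner V_L (rev ?ss)) = inner (mat_adjoint V_L) ?ss"
    unfolding inner_def N_def by (rule mat_adjoint_on_inner_product[OF V(2)]) auto
  moreover have "mat_adjoint (ctrl A_L (rev ?ss) * on_outer n d POLY_L) =
      on_outer n d (mat_adjoint POLY_L) * ctrl (mat_adjoint A_L) ?ss"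
    unfolding ctrl_def N_def by (rule adjoint_preparation[OF A(2) POLY_L])
  ultimately have adj_L': "mat_adjoint L' =
      (on_outer n d (mat_adjoint POLY_L) * ctrl (mat_adjoint A_L) ?ss) * inner (mat_adjoint V_L) ?ss"
    unfolding L'_def by (simp only: mat_adjoint_mult[OF inner mult_carrier_mat[OF ctrl outer]])
  have W: "circuit_W n d POLY_R POLY_L (V_R * A_R) (V_L * A_L) *\<^sub>v ancilla_init n d \<phi> = mat_adjoint L *\<^sub>v y"
  proof -
    have "circuit_W n d POLY_R POLY_L (V_R * A_R) (V_L * A_L) = mprod N [on_outer n d (mat_adjoint POLY_L),
        ctrl (mat_adjoint (V_L * A_L)) ?ss, SEL, ctrl (V_R * A_R) (rev ?ss), on_outer n d POLY_R]"
      by (simp only: circuit_W_def Let_def ctrl_def SEL_def N_def)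
    moreover have "\<dots> *\<^sub>v ancilla_init n d \<phi> = foldr (*\<^sub>v) [on_outer n d (mat_adjoint POLY_L),
        ctrl (mat_adjoint (V_L * A_L)) ?ss, SEL, ctrl (V_R * A_R) (rev ?ss), on_outer n d POLY_R] (ancilla_init n d \<phi>)"
      by (rule mprod_mult_vec) (simp_all only: list.set insert_subset empty_subsetI carriers init \<phi> simp_thms)
    ultimately show ?thesis
      unfolding adj_L assoc[OF outer ctrl yc] by (simp only: foldr.simps comp_apply id_apply y_def)
  qed
  have W': "circuit_W_simplified n d POLY_R POLY_L V_R V_L A_R A_L *\<^sub>v ancilla_init n d \<phi> = mat_adjoint L' *\<^sub>v y"
  proof -
    have "circuit_W_simplified n d POLY_R POLY_L V_R V_L A_R A_L = mprod N [on_outer n d (mat_adjoint POLY_L),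
        ctrl (mat_adjoint A_L) ?ss, inner (mat_adjoint V_L) ?ss, SEL, inner V_R ?ss, ctrl A_R (rev ?ss), on_outer n d POLY_R]"
      by (simp only: circuit_W_simplified_def Let_def ctrl_def inner_def SEL_def N_def)
    moreover have "\<dots> *\<^sub>v ancilla_init n d \<phi> = foldr (*\<^sub>v) [on_outer n d (mat_adjoint POLY_L),
        ctrl (mat_adjoint A_L) ?ss, inner (mat_adjoint V_L) ?ss, SEL, inner V_R ?ss, ctrl A_R (rev ?ss), on_outer n d POLY_R]
        (ancilla_init n d \<phi>)"
      by (rule mprod_mult_vec) (simp_all only: list.set insert_subset empty_subsetI carriers init \<phi> simp_thms)
    moreover have "inner V_R ?ss *\<^sub>v (ctrl A_R (rev ?ss) *\<^sub>v (on_outer n d POLY_R *\<^sub>v ancilla_init n d \<phi>)) =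
        ctrl (V_R * A_R) (rev ?ss) *\<^sub>v (on_outer n d POLY_R *\<^sub>v ancilla_init n d \<phi>)"
      by (rule absorb[OF V(1) A(1) fix0(1) \<phi>]) auto
    ultimately show ?thesis
      unfolding adj_L' assoc[OF mult_carrier_mat[OF outer ctrl] inner yc] assoc[OF outer ctrl mv[OF inner yc]]
      by (simp only: foldr.simps comp_apply id_apply y_def)
  qed
  have "ancilla_postselect n d *\<^sub>v (mat_adjoint L *\<^sub>v y) = ancilla_postselect n d *\<^sub>v (mat_adjoint L' *\<^sub>v y)"
  \<comment> \<open>Agreement of \<open>L\<close> and \<open>L'\<close> on initialized states
    suffices, since post-selection sees nothing else of their adjoints.\<close>
  proof (rule ancilla_postselect_adjoint_cong[OF L[unfolded N_def] L'[unfolded N_def] _ yc[unfolded N_def]])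
    fix \<psi> :: "complex vec" assume \<psi>: "\<psi> \<in> carrier_vec (2 ^ n)"
    have "inner V_L (rev ?ss) *\<^sub>v (ctrl A_L (rev ?ss) *\<^sub>v (on_outer n d POLY_L *\<^sub>v ancilla_init n d \<psi>)) =
        ctrl (V_L * A_L) (rev ?ss) *\<^sub>v (on_outer n d POLY_L *\<^sub>v ancilla_init n d \<psi>)"
      by (rule absorb[OF V(2) A(2) fix0(2) \<psi>]) auto
    then show "L *\<^sub>v ancilla_init n d \<psi> = L' *\<^sub>v ancilla_init n d \<psi>"
      unfolding L_def L'_def assoc[OF ctrl outer init[OF \<psi>]]
        assoc[OF inner mult_carrier_mat[OF ctrl outer] init[OF \<psi>]] by simp
  qed
  then show ?thesis by (simp only: W W')
qed

text \<open>The oracles are families indexed by the number \<open>m\<close> of qubits, because "O(1)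
  gates" means one bound \<open>C\<close> for all \<open>m\<close>; the circuits are compared at
  \<open>m = n\<close>. The real \<open>\<theta>\<close> is the value chosen for the argument of
  0.\<close>

theorem corollary5:
  fixes H P_R P_L V_R V_L A_R A_L :: "nat \<Rightarrow> complex mat"
    and \<alpha> :: "nat \<Rightarrow> nat \<Rightarrow> nat \<Rightarrow> complex"
    and \<theta> :: real
    and n d :: nat
    and a :: "nat \<Rightarrow> complex"
    and POLY_R POLY_L :: "complex mat"
  assumes H_dim: "\<And>m. m \<ge> 1 \<Longrightarrow> H m \<in> carrier_mat (2 ^ m) (2 ^ m)"
    and H_nonzero: "\<And>m. m \<ge> 1 \<Longrightarrow> H m \<noteq> 0\<^sub>m (2 ^ m) (2 ^ m)"
    and H_pauli: "\<And>m. m \<ge> 1 \<Longrightarrow> H m = pauli_sum m (\<alpha> m)"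
    and P_R_unitary: "\<And>m. m \<ge> 1 \<Longrightarrow> unitary_on (2 * m) (P_R m)"
    and P_L_unitary: "\<And>m. m \<ge> 1 \<Longrightarrow> unitary_on (2 * m) (P_L m)"
    and P_R_prep: "\<And>m. m \<ge> 1 \<Longrightarrow> P_R m *\<^sub>v ket (2 * m) 0 = prep_state_R \<theta> m (\<alpha> m)"
    and P_L_prep: "\<And>m. m \<ge> 1 \<Longrightarrow> P_L m *\<^sub>v ket (2 * m) 0 = prep_state_L m (\<alpha> m)"
    and V_R_unitary: "\<And>m. m \<ge> 1 \<Longrightarrow> unitary_on (2 * m) (V_R m)"
    and V_L_unitary: "\<And>m. m \<ge> 1 \<Longrightarrow> unitary_on (2 * m) (V_L m)"
    and A_R_unitary: "\<And>m. m \<ge> 1 \<Longrightarrow> unitary_on (2 * m) (A_R m)"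
    and A_L_unitary: "\<And>m. m \<ge> 1 \<Longrightarrow> unitary_on (2 * m) (A_L m)"
    and P_R_factor: "\<And>m. m \<ge> 1 \<Longrightarrow> P_R m = V_R m * A_R m"
    and P_L_factor: "\<And>m. m \<ge> 1 \<Longrightarrow> P_L m = V_L m * A_L m"
    and V_R_fix: "\<And>m. m \<ge> 1 \<Longrightarrow> V_R m *\<^sub>v ket (2 * m) 0 = ket (2 * m) 0"
    and V_L_fix: "\<And>m. m \<ge> 1 \<Longrightarrow> V_L m *\<^sub>v ket (2 * m) 0 = ket (2 * m) 0"
    and A_gates: "\<exists>C. \<forall>m\<ge>1. single_qubit_gates (2 * m) C (A_R m) \<and> single_qubit_gates (2 * m) C (A_L m)"
    and n: "n \<ge> 1" and d: "d \<ge> 1" and a_d: "a d \<noteq> 0"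
    and POLY_R_unitary: "unitary_on d POLY_R"
    and POLY_L_unitary: "unitary_on d POLY_L"
    and POLY_R_prep: "POLY_R *\<^sub>v ket d 0 = poly_state_R \<theta> (coeff_norm n (\<alpha> n)) d a"
    and POLY_L_prep: "POLY_L *\<^sub>v ket d 0 = poly_state_L (coeff_norm n (\<alpha> n)) d a"
  shows "\<forall>\<phi>. qubit_state n \<phi> \<longrightarrow>
     ancilla_postselect n d *\<^sub>v
       (circuit_W n d POLY_R POLY_L (P_R n) (P_L n) *\<^sub>v ancilla_init n d \<phi>) =
     ancilla_postselect n d *\<^sub>v
       (circuit_W_simplified n d POLY_R POLY_L (V_R n) (V_L n) (A_R n) (A_L n) *\<^sub>v ancilla_init n d \<phi>)"
proof (intro allI impI)
  fix \<phi> assume "qubit_state n \<phi>"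
  then have \<phi>: "\<phi> \<in> carrier_vec (2 ^ n)" by (simp add: qubit_state_def)
  note carriers = V_R_unitary[OF n] V_L_unitary[OF n] A_R_unitary[OF n] A_L_unitary[OF n] POLY_L_unitary
  show "ancilla_postselect n d *\<^sub>v
       (circuit_W n d POLY_R POLY_L (P_R n) (P_L n) *\<^sub>v ancilla_init n d \<phi>) =
     ancilla_postselect n d *\<^sub>v
       (circuit_W_simplified n d POLY_R POLY_L (V_R n) (V_L n) (A_R n) (A_L n) *\<^sub>v ancilla_init n d \<phi>)"
    unfolding P_R_factor[OF n] P_L_factor[OF n]
    by (rule circuit_W_postselect_eq[OF _ _ _ _ _ V_R_fix[OF n] V_L_fix[OF n] \<phi>])
      (use carriers in \<open>simp_all add: unitary_on_def\<close>)
qed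

end
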